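(* Let $\phi:\mathbb{R}\to\mathbb{R}$ be a continuous function such that $\phi(0)=0$ and $\limsup_{s\to 0}\phi(s)/|s|<\infty$. Suppose moreover that there exist $A>0$ and $1<p<1+\sqrt{2}$ such that $\phi(s)\ge A|s|^p$ for all $s\in\mathbb{R}$. Let $f\in C^3(\mathbb{R}^3)$ and $g\in C^2(\mathbb{R}^3)$ be real-valued functions, both with compact support. If $u\in C^2(\mathbb{R}^3\times[0,\infty))$ is a real-valued function satisfying $$\begin{cases}\Box u(x,t)=\phi(u(x,t)) & \text{for } x\in\mathbb{R}^3,\ t\in(0,\infty),\\ u(x,0)=f(x) & \text{for } x\in\mathbb{R}^3,\\ u_t(x,0)=g(x) & \text{for } x\in\mathbb{R}^3,\end{cases}$$ then $u\equiv 0$ in $\mathbb{R}^3\times[0,\infty)$.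
   Context: $\Box$ denotes the d'Alembertian operator $\Box=\frac{\partial^2}{\partial t^2}-\sum_{i=1}^{3}\frac{\partial^2}{\partial x_i^2}$, where $x=(x_1,x_2,x_3)\in\mathbb{R}^3$ and $t$ is time. *)

theory Defs
  imports "HOL-Analysis.Analysis"
begin

(* f is of class C^k on S. The derivatives are taken within S, so at boundary points they are
   one-sided; D b is the partial derivative of f in the direction of the basis vector b. Intended
   for convex S with nonempty interior (the whole space, a closed half-space), where the derivative
   within S is unique. Only the values of f on S matter. *)
primrec C_class_on ::
    "nat \<Rightarrow> ('a::euclidean_space) set \<Rightarrow> ('a \<Rightarrow> real) \<Rightarrow> bool" where
  "C_class_on 0 S f \<longleftrightarrow> continuous_on S f"
| "C_class_on (Suc k) S f \<longleftrightarrow>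
     (\<exists>D. (\<forall>z\<in>S. (f has_derivative (\<lambda>h. \<Sum>b\<in>Basis. (h \<bullet> b) * D b z)) (at z within S)) \<and>
          (\<forall>b\<in>Basis. C_class_on k S (D b)))"

definition compactly_supported :: "('a::euclidean_space \<Rightarrow> real) \<Rightarrow> bool" where
  "compactly_supported f \<longleftrightarrow> compact (closure {x. f x \<noteq> 0})"

definition second_partial :: "'a::euclidean_space \<Rightarrow> ('a \<Rightarrow> real) \<Rightarrow> 'a \<Rightarrow> real" where
  "second_partial b f z = deriv (deriv (\<lambda>s. f (z + s *\<^sub>R b))) 0"

(* (0, 1) is the time direction and (axis i 1, 0) the i-th space direction. *)
definition dAlembertian :: "((real^3) \<times> real \<Rightarrow> real) \<Rightarrow> (real^3) \<times> real \<Rightarrow> real" where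
  "dAlembertian u z =
     second_partial (0, 1) u z - (\<Sum>i\<in>UNIV. second_partial (axis i 1, 0) u z)"

end

(* For n on the unit sphere let v(r, t) be r times the mean of u(r n, t). The means turn the
   equation into v_tt - v_rr = r h with h >= c |v / r|^p by Jensen's inequality, and for t - r > R the
   data no longer contribute. In null coordinates one positive value of v propagates to a lower
   bound v >= c L^(1-p) r on the triangle R' <= t - r, t + r <= L. Such a linear bound doubles on
   shorter and shorter intervals of t - r whose total length is of order L^((p-1)^2/2), which is
   less than L for large L since p < 1 + sqrt 2; so v would be infinite. Hence v = 0 for t - r > R,
   which forces h = 0, and so u = 0, for t + |x| > R. Finally u vanishes for late times and phi(u) is
   dominated by |u|, so the same means about arbitrary centres give uniqueness backwards in time. *)

theory Submission
  imports Defs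
begin

section \<open>Blow-up in null coordinates\<close>

text \<open>In null coordinates the equation splits into two first-order statements: W = v_t + v_r
  has derivative r h along incoming lines, and v is recovered from W along outgoing lines, starting
  with 0 on the axis. Although u and its data have no sign, W does: it vanishes where an incoming
  line t + r = \<xi> > R meets t = 0, and it grows from there because h >= 0. The exponents come
  from scaling. A bound v >= Y r turns the right-hand side into a multiple of Y^p r, which adds
  order Y^p \<delta>^2 to W across a strip of width \<delta>; doubling Y therefore needs \<delta> of
  order Y^(-(p-1)/2). The power L^(1-p) is the weight r^(1-p), left over when r |v/r|^p is written
  with |v|^p, at distance r of order L. Blow-up gives v = 0 only for t - r > R. Monotonicity carries
  this further: on an incoming line with \<xi> > R, W is zero at t = 0 and again near the axis,
  hence in between, so h = 0 on the whole line. The compact rest t + |x| <= R is out of reach of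
  blow-up; there the linear bound on \<phi> near 0 takes over.\<close>

lemma increment_ge:
  fixes f :: "real \<Rightarrow> real"
  assumes "a \<le> b" "continuous_on {a..b} f"
    and "\<And>x. a < x \<Longrightarrow> x < b \<Longrightarrow> \<exists>d\<ge>m. (f has_real_derivative d) (at x)"
  shows "m * (b - a) \<le> f b - f a"
proof (cases "a = b")
  case False
  then have "a < b" using assms by simp
  then obtain l z where z: "a < z" "z < b" "DERIV f z :> l" "f b - f a = (b - a) * l"
    using MVT[of a b f] assms(2,3) real_differentiable_def by blast
  then obtain d where "d \<ge> m" "DERIV f z :> d" using assms(3) by blast
  with z(3) have "m \<le> l" using DERIV_unique by blast
  then show ?thesis using \<open>a < b\<close> z(4) by (simp add: mult.commute mult_left_mono)
qed simp

text \<open>\<open>V\<close> will be r times a spherical integral in the coordinates \<alpha> = t +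
  r and \<beta> = t - r, and \<open>Q\<close> its \<alpha>-derivative; \<open>V_diag\<close> is the
  axis r = 0. The weight arises because r |m|^p = r^(1-p) |r m|^p.\<close>

locale characteristic_pair =
  fixes V Q :: "real \<Rightarrow> real \<Rightarrow> real" and p K R :: real
  assumes p: "1 < p" "p < 1 + sqrt 2" and K: "0 < K" and R: "0 < R"
    and V_diag: "\<And>\<beta>. R < \<beta> \<Longrightarrow> V \<beta> \<beta> = 0"
    and V_cont_left: "\<And>\<beta>. R < \<beta> \<Longrightarrow> continuous_on {\<beta>..} (\<lambda>\<alpha>. V \<alpha> \<beta>)"
    and V_cont_right: "\<And>\<alpha> \<beta>. R < \<beta> \<Longrightarrow> \<beta> < \<alpha> \<Longrightarrow> isCont (\<lambda>\<beta>. V \<alpha> \<beta>) \<beta>"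
    and V_deriv: "\<And>\<alpha> \<beta>. R < \<beta> \<Longrightarrow> \<beta> < \<alpha> \<Longrightarrow>
      ((\<lambda>\<alpha>. V \<alpha> \<beta>) has_real_derivative Q \<alpha> \<beta>) (at \<alpha>)"
    and Q_nonneg: "\<And>\<alpha> \<beta>. R < \<beta> \<Longrightarrow> \<beta> < \<alpha> \<Longrightarrow> 0 \<le> Q \<alpha> \<beta>"
    and Q_deriv: "\<And>\<alpha> \<beta>. R < \<beta> \<Longrightarrow> \<beta> < \<alpha> \<Longrightarrow>
      \<exists>d \<ge> K * (\<alpha> - \<beta>) powr (1 - p) * \<bar>V \<alpha> \<beta>\<bar> powr p.
        ((\<lambda>\<beta>. Q \<alpha> \<beta>) has_real_derivative d) (at \<beta>)"
begin

lemma V_increment: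
  assumes "R < \<beta>" "\<beta> \<le> a" "a \<le> \<alpha>" "\<And>x. a < x \<Longrightarrow> x < \<alpha> \<Longrightarrow> m \<le> Q x \<beta>"
  shows "m * (\<alpha> - a) \<le> V \<alpha> \<beta> - V a \<beta>"
proof (rule increment_ge)
  show "continuous_on {a..\<alpha>} (\<lambda>\<alpha>. V \<alpha> \<beta>)"
    using V_cont_left[OF assms(1)] assms(2) by (rule_tac continuous_on_subset) auto
next
  fix x assume "a < x" "x < \<alpha>"
  then show "\<exists>d\<ge>m. ((\<lambda>\<alpha>. V \<alpha> \<beta>) has_real_derivative d) (at x)"
    using V_deriv[of \<beta> x] assms by auto
qed (use assms in auto)

lemma Q_increment:
  assumes "R < b" "b \<le> \<beta>" "\<beta> < \<alpha>"
    and "\<And>x. b < x \<Longrightarrow> x < \<beta> \<Longrightarrow> m \<le> K * (\<alpha> - x) powr (1 - p) * \<bar>V \<alpha> x\<bar> powr p"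
  shows "m * (\<beta> - b) \<le> Q \<alpha> \<beta> - Q \<alpha> b"
proof (rule increment_ge)
  show "continuous_on {b..\<beta>} (Q \<alpha>)"
  proof (rule continuous_at_imp_continuous_on, rule ballI)
    fix x assume "x \<in> {b..\<beta>}"
    then show "isCont (Q \<alpha>) x"
      using Q_deriv[of x \<alpha>] assms by (auto intro: DERIV_isCont)
  qed
next
  fix x assume "b < x" "x < \<beta>"
  then show "\<exists>d\<ge>m. (Q \<alpha> has_real_derivative d) (at x)"
    using Q_deriv[of x \<alpha>] assms(4)[of x] assms(1-3) by (meson order.trans order.strict_trans order.strict_trans1 order.strict_trans2)
qed (use assms in auto)

lemma Q_mono: "R < b \<Longrightarrow> b \<le> \<beta> \<Longrightarrow> \<beta> < \<alpha> \<Longrightarrow> Q \<alpha> b \<le> Q \<alpha> \<beta>"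
  using Q_increment[of b \<beta> \<alpha> 0] K by simp

lemma V_mono: "R < \<beta> \<Longrightarrow> \<beta> \<le> a \<Longrightarrow> a \<le> \<alpha> \<Longrightarrow> V a \<beta> \<le> V \<alpha> \<beta>"
  using V_increment[of \<beta> a \<alpha> 0] Q_nonneg by auto

lemma V_nonneg: "R < \<beta> \<Longrightarrow> \<beta> \<le> \<alpha> \<Longrightarrow> 0 \<le> V \<alpha> \<beta>"
  using V_mono[of \<beta> \<beta> \<alpha>] V_diag[of \<beta>] by simp

text \<open>Inserting the linear bound cancels the weight: (x - y)^(1-p) (Y (x - y))^p = Y^p (x -
  y). Integrating this in \<beta> over a strip bounds \<open>Q\<close> below by a constant, and
  integrating \<open>Q\<close> from the axis gives a linear bound again.\<close>

lemma doubling: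
  assumes b: "R < b" and Y: "0 < Y"
    and lower: "\<And>\<alpha> \<beta>. b \<le> \<beta> \<Longrightarrow> \<beta> \<le> \<alpha> \<Longrightarrow> \<alpha> \<le> L \<Longrightarrow> Y * (\<alpha> - \<beta>) \<le> V \<alpha> \<beta>"
    and \<delta>: "\<delta> = sqrt (8 / K) * Y powr (- (p - 1) / 2)"
    and \<alpha>\<beta>: "b + \<delta> \<le> \<beta>" "\<beta> \<le> \<alpha>" "\<alpha> \<le> L"
  shows "2 * Y * (\<alpha> - \<beta>) \<le> V \<alpha> \<beta>"
proof -
  have \<delta>0: "0 < \<delta>" using K Y by (simp add: \<delta>)
  have "K * Y powr p * \<delta>\<^sup>2 = 8 * (Y powr p * (Y powr (- (p - 1) / 2) * Y powr (- (p - 1) / 2)))"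
    using K by (simp add: \<delta> power_mult_distrib power2_eq_square)
  also have "\<dots> = 8 * Y"
    using Y by (simp flip: powr_add)
  finally have \<delta>2: "K * Y powr p * \<delta>\<^sup>2 = 8 * Y" .
  have Q: "2 * Y \<le> Q x \<beta>" if x: "\<beta> < x" "x < \<alpha>" for x
  proof -
    \<comment> \<open>Only the first half of the strip is used: there x - y exceeds \<delta> / 2.
      The gain is K Y^p (\<delta> / 2)^2, and requiring it to be 2 Y produces the 8 in
      \<delta>.\<close>
    have "K * Y powr p * (\<delta> / 2) * (b + \<delta> / 2 - b) \<le> Q x (b + \<delta> / 2) - Q x b"
    proof (rule Q_increment)
      fix y assume y: "b < y" "y < b + \<delta> / 2"
      have "K * Y powr p * (\<delta> / 2) \<le> K * Y powr p * (x - y)"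
        using y x \<alpha>\<beta> K by (intro mult_left_mono) auto
      also have "\<dots> = K * (x - y) powr (1 - p) * (Y * (x - y)) powr p"
        using y x \<alpha>\<beta> Y \<delta>0 by (simp add: powr_mult flip: powr_add)
      also have "\<dots> \<le> K * (x - y) powr (1 - p) * \<bar>V x y\<bar> powr p"
      proof (rule mult_left_mono[OF powr_mono2])
        show "Y * (x - y) \<le> \<bar>V x y\<bar>" using lower[of y x] y x \<alpha>\<beta> \<delta>0 by simp
      qed (use y x \<alpha>\<beta> Y \<delta>0 K p in auto)
      finally show "K * Y powr p * (\<delta> / 2) \<le> K * (x - y) powr (1 - p) * \<bar>V x y\<bar> powr p" .
    qed (use b x \<alpha>\<beta> \<delta>0 in auto)
    moreover have "Q x (b + \<delta> / 2) \<le> Q x \<beta>"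
      using Q_mono[of "b + \<delta>/2" \<beta> x] b x \<alpha>\<beta> \<delta>0 by simp
    moreover have "0 \<le> Q x b" using Q_nonneg[of b x] b x \<alpha>\<beta> \<delta>0 by simp
    moreover have "K * Y powr p * (\<delta> / 2) * (b + \<delta> / 2 - b) = 2 * Y"
      using \<delta>2 by (simp add: power2_eq_square field_simps)
    ultimately show ?thesis by linarith
  qed
  have "2 * Y * (\<alpha> - \<beta>) \<le> V \<alpha> \<beta> - V \<beta> \<beta>"
    using V_increment[of \<beta> \<beta> \<alpha> "2 * Y"] Q b \<delta>0 \<alpha>\<beta> by simp
  then show ?thesis using V_diag[of \<beta>] b \<delta>0 \<alpha>\<beta> by simp
qed

text \<open>A linear lower bound on the triangle below \<open>L\<close> is doubled over lengths that form a geometric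
  series; if that series stays below \<open>L\<close>, the solution is infinite inside the triangle.\<close>

lemma triangle_too_small:
  assumes b: "R < b" and Y: "0 < Y"
    and lower: "\<And>\<alpha> \<beta>. b \<le> \<beta> \<Longrightarrow> \<beta> \<le> \<alpha> \<Longrightarrow> \<alpha> \<le> L \<Longrightarrow> Y * (\<alpha> - \<beta>) \<le> V \<alpha> \<beta>"
  shows "L \<le> b + sqrt (8 / K) * Y powr (- (p - 1) / 2) / (1 - 2 powr (- (p - 1) / 2))"
proof (rule ccontr)
  define q :: real where "q = 2 powr (- (p - 1) / 2)"
  define D where "D = sqrt (8 / K) * Y powr (- (p - 1) / 2)"
  have q: "0 < q" "q < 1" using p by (auto simp: q_def powr_less_one)
  have D: "0 < D" using K Y by (simp add: D_def)
  \<comment> \<open>Doubling Y multiplies the required width by \<open>q\<close>, so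
    \<open>s n\<close> is where the bound with slope 2^n Y begins.\<close>
  define s where "s n = b + D * (\<Sum>i<n. q ^ i)" for n
  assume "\<not> ?thesis"
  then have L: "b + D / (1 - q) < L" by (simp add: q_def D_def)
  have s_le: "s n \<le> b + D / (1 - q)" for n
  proof -
    have "(\<Sum>i<n. q ^ i) \<le> 1 / (1 - q)"
      using q by (simp add: sum_gp_strict divide_right_mono)
    then have "D * (\<Sum>i<n. q ^ i) \<le> D * (1 / (1 - q))"
      using D by (intro mult_left_mono) auto
    then show ?thesis by (simp add: s_def)
  qed
  have s_ge: "b \<le> s n" for n
    using D q by (simp add: s_def sum_nonneg)
  have iter: "2 ^ n * Y * (\<alpha> - \<beta>) \<le> V \<alpha> \<beta>" if "s n \<le> \<beta>" "\<beta> \<le> \<alpha>" "\<alpha> \<le> L" for n \<alpha> \<beta>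
    using that
  proof (induction n arbitrary: \<alpha> \<beta>)
    case 0
    then show ?case using lower by (simp add: s_def)
  next
    case (Suc n)
    have "(2 ^ n) powr (- (p - 1) / 2) = q ^ n"
      unfolding q_def by (induction n) (auto simp: powr_mult)
    then have "sqrt (8 / K) * (2 ^ n * Y) powr (- (p - 1) / 2) = D * q ^ n"
      using Y by (simp add: D_def powr_mult)
    moreover have "s (Suc n) = s n + D * q ^ n" by (simp add: s_def distrib_left)
    ultimately have "2 * (2 ^ n * Y) * (\<alpha> - \<beta>) \<le> V \<alpha> \<beta>"
      using doubling[of "s n" "2 ^ n * Y" L "D * q ^ n" \<beta> \<alpha>] Suc b Y s_ge[of n] by force
    then show ?case by simp
  qed
  \<comment> \<open>This limit of the \<open>s n\<close> lies below L, so at the single point (L,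
    \<beta>) all the doubled bounds hold at once.\<close>
  define \<beta> where "\<beta> = b + D / (1 - q)"
  have "0 < Y * (L - \<beta>)" using Y L by (simp add: \<beta>_def)
  then obtain n where "V L \<beta> < of_nat n * (Y * (L - \<beta>))"
    using ex_less_of_nat_mult by blast
  also have "\<dots> \<le> 2 ^ n * (Y * (L - \<beta>))"
    using \<open>0 < Y * (L - \<beta>)\<close> of_nat_less_two_power[of n, where 'a=real] by (intro mult_right_mono) auto
  also have "\<dots> \<le> V L \<beta>"
    using iter[of n \<beta> L] s_le L by (simp add: \<beta>_def mult.assoc)
  finally show False by simp
qed

text \<open>A positive value persists for slightly larger \<beta> by continuity and for all larger
  \<alpha> by monotonicity, hence on an unbounded strip between two outgoing lines. Every incoming
  line up to L crosses the strip at a point where the weight is at least L^(1-p), because 1 - p < 0.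
  The crossing raises \<open>Q\<close> by a fixed multiple of this, and \<open>Q\<close> cannot
  decrease afterwards.\<close>

lemma linear_lower_bound:
  assumes "R < \<beta>" "\<beta> \<le> \<alpha>" "0 < V \<alpha> \<beta>"
  obtains B c where "R < B" "0 < c"
    "\<And>L \<alpha> \<beta>. B \<le> \<beta> \<Longrightarrow> \<beta> \<le> \<alpha> \<Longrightarrow> \<alpha> \<le> L \<Longrightarrow> c * L powr (1 - p) * (\<alpha> - \<beta>) \<le> V \<alpha> \<beta>"
proof -
  have "\<beta> \<noteq> \<alpha>" using assms V_diag[of \<beta>] by auto
  then have "\<beta> < \<alpha>" using assms by simp
  define v where "v = V \<alpha> \<beta> / 2"
  have v: "0 < v" using assms by (simp add: v_def)
  have "eventually (\<lambda>y. v < V \<alpha> y) (at \<beta>)"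
    using V_cont_right[OF assms(1) \<open>\<beta> < \<alpha>\<close>] assms(3)
    unfolding isCont_def by (intro order_tendstoD(1)) (auto simp: v_def)
  then obtain e where e: "e > 0" "\<And>y. y \<noteq> \<beta> \<Longrightarrow> dist y \<beta> < e \<Longrightarrow> v < V \<alpha> y"
    unfolding eventually_at by auto
  define b where "b = \<beta> + min (e / 2) ((\<alpha> - \<beta>) / 2)"
  have b: "\<beta> < b" "b < \<alpha>" using e \<open>\<beta> < \<alpha>\<close> by (auto simp: b_def min_def field_simps)
  have v_less: "v < V \<alpha> y" if "\<beta> < y" "y < b" for y
    using that e(1) by (intro e(2)) (auto simp: dist_real_def b_def)
  define c where "c = K * v powr p * (b - \<beta>)"
  have c: "0 < c" using K v b by (simp add: c_def)
  show ?thesis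
  proof (rule that[of \<alpha> c])
    fix L \<alpha>' \<beta>' assume *: "\<alpha> \<le> \<beta>'" "\<beta>' \<le> \<alpha>'" "\<alpha>' \<le> L"
    have Q: "c * L powr (1 - p) \<le> Q x \<beta>'" if x: "\<beta>' < x" "x < \<alpha>'" for x
    proof -
      have "K * L powr (1 - p) * v powr p * (b - \<beta>) \<le> Q x b - Q x \<beta>"
      proof (rule Q_increment)
        fix y assume y: "\<beta> < y" "y < b"
        have "v \<le> \<bar>V x y\<bar>"
          using v_less[OF y] V_mono[of y \<alpha> x] y b x * assms by auto
        moreover have "L powr (1 - p) \<le> (x - y) powr (1 - p)"
          using p y b x * assms R by (intro powr_mono2') auto
        ultimately show "K * L powr (1 - p) * v powr p \<le> K * (x - y) powr (1 - p) * \<bar>V x y\<bar> powr p"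
          using K v p
          by (intro mult_mono[where c = "v powr p"] mult_left_mono[of "L powr (1 - p)"] powr_mono2[of p v]) auto
      qed (use b x * assms in auto)
      moreover have "Q x b \<le> Q x \<beta>'" using b x * assms by (intro Q_mono) auto
      moreover have "0 \<le> Q x \<beta>" using b x * assms by (intro Q_nonneg) auto
      moreover have "K * L powr (1 - p) * v powr p * (b - \<beta>) = c * L powr (1 - p)"
        by (simp add: c_def)
      ultimately show ?thesis by linarith
    qed
    have "c * L powr (1 - p) * (\<alpha>' - \<beta>') \<le> V \<alpha>' \<beta>' - V \<beta>' \<beta>'"
      using V_increment[of \<beta>' \<beta>' \<alpha>' "c * L powr (1 - p)"] Q b * assms by simp
    then show "c * L powr (1 - p) * (\<alpha>' - \<beta>') \<le> V \<alpha>' \<beta>'"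
      using V_diag[of \<beta>'] b * assms by simp
  qed (use b c assms in auto)
qed

text \<open>The critical exponent enters through \<open>(p - 1)\<^sup>2 / 2 < 1\<close>: with the lower bound of order
  \<open>L powr (1 - p)\<close> the blow-up length is of order \<open>L powr ((p - 1)\<^sup>2 / 2)\<close>.\<close>

theorem V_eq_0:
  assumes "R < \<beta>" "\<beta> \<le> \<alpha>"
  shows "V \<alpha> \<beta> = 0"
proof (rule ccontr)
  assume "V \<alpha> \<beta> \<noteq> 0"
  then have "0 < V \<alpha> \<beta>" using V_nonneg[OF assms] by simp
  from linear_lower_bound[OF assms this] obtain B c where Bc: "R < B" "0 < c"
    "\<And>L \<alpha> \<beta>. B \<le> \<beta> \<Longrightarrow> \<beta> \<le> \<alpha> \<Longrightarrow> \<alpha> \<le> L \<Longrightarrow> c * L powr (1 - p) * (\<alpha> - \<beta>) \<le> V \<alpha> \<beta>"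
    by blast
  define C where "C = sqrt (8 / K) * c powr (- (p - 1) / 2) / (1 - 2 powr (- (p - 1) / 2))"
  define e where "e = (p - 1)\<^sup>2 / 2"
  have bound: "L \<le> B + C * L powr e" if "0 < L" for L
  proof -
    have "(c * L powr (1 - p)) powr (- (p - 1) / 2) = c powr (- (p - 1) / 2) * L powr e"
      using that Bc by (simp add: powr_mult powr_powr e_def power2_eq_square field_simps)
    then show ?thesis
      using triangle_too_small[of B "c * L powr (1 - p)" L] Bc that by (simp add: C_def)
  qed
  have "(p - 1)\<^sup>2 < (sqrt 2)\<^sup>2" using p by (intro power_strict_mono) auto
  then have e: "e < 1" by (simp add: e_def)
  \<comment> \<open>Divided by L, \<open>bound\<close> says that 1 is at most this expression, which
    tends to 0.\<close>
  have "((\<lambda>L. B * L powr - 1 + C * L powr (e - 1)) \<longlongrightarrow> B * 0 + C * 0) at_top"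
    using e by (intro tendsto_intros tendsto_neg_powr filterlim_ident) auto
  then have "eventually (\<lambda>L. B * L powr - 1 + C * L powr (e - 1) < 1) at_top"
    by (intro order_tendstoD(2)[where y = "B * 0 + C * 0"]) auto
  then have "eventually (\<lambda>L. B * L powr - 1 + C * L powr (e - 1) < 1 \<and> 0 < L) at_top"
    using eventually_gt_at_top eventually_conj by blast
  then obtain L where L: "B * L powr - 1 + C * L powr (e - 1) < 1" "0 < L"
    using eventually_happens' trivial_limit_at_top_linorder by blast
  have "B + C * L powr e = L * (B * L powr - 1 + C * L powr (e - 1))"
    using L by (simp add: powr_minus powr_diff field_simps)
  also have "\<dots> < L * 1" using L by (intro mult_strict_left_mono)
  finally show False using bound[OF L(2)] by simp
qed

lemma Q_eq_0:
  assumes "R < \<beta>" "\<beta> < \<alpha>"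
  shows "Q \<alpha> \<beta> = 0"
proof -
  have "eventually (\<lambda>x. x \<in> {\<beta><..}) (nhds \<alpha>)" using assms by (intro eventually_nhds_in_open) auto
  then have "eventually (\<lambda>x. V x \<beta> = 0) (nhds \<alpha>)"
    by eventually_elim (use V_eq_0 assms in auto)
  then have "((\<lambda>x. V x \<beta>) has_real_derivative 0) (at \<alpha>)"
    using DERIV_cong_ev[of \<alpha> \<alpha> "\<lambda>x. V x \<beta>" "\<lambda>_. 0" 0 0] by simp
  then show ?thesis using V_deriv[OF assms] DERIV_unique by blast
qed

end

section \<open>Integrals over the unit sphere\<close>

definition e_r :: "real \<Rightarrow> real \<Rightarrow> real^3" where
  "e_r \<theta> \<psi> = (sin \<theta> * cos \<psi>) *\<^sub>R axis 1 1 + (sin \<theta> * sin \<psi>) *\<^sub>R axis 2 1 + cos \<theta> *\<^sub>R axis 3 1"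

definition e_polar :: "real \<Rightarrow> real \<Rightarrow> real^3" where
  "e_polar \<theta> \<psi> = (cos \<theta> * cos \<psi>) *\<^sub>R axis 1 1 + (cos \<theta> * sin \<psi>) *\<^sub>R axis 2 1 + (- sin \<theta>) *\<^sub>R axis 3 1"

text \<open>The \<psi>-derivative of \<open>e_r\<close> without its factor sin \<theta>; this keeps
  it a unit vector at the poles, so the frame is orthonormal for all angles.\<close>

definition e_azimuth :: "real \<Rightarrow> real^3" where
  "e_azimuth \<psi> = (- sin \<psi>) *\<^sub>R axis 1 1 + cos \<psi> *\<^sub>R axis 2 1"

text \<open>The surface integral in spherical coordinates, with area density sin \<theta>. It is not
  normalised: the sphere has total mass 4 pi, which accounts for the factors 4 pi below.\<close>

definition sphere_integral :: "(real^3 \<Rightarrow> real) \<Rightarrow> real" where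
  "sphere_integral F = integral (cbox (0, 0) (pi, 2 * pi)) (\<lambda>q. sin (fst q) * F (e_r (fst q) (snd q)))"

lemma frame_nth [simp]:
  "e_r \<theta> \<psi> $ 1 = sin \<theta> * cos \<psi>" "e_r \<theta> \<psi> $ 2 = sin \<theta> * sin \<psi>" "e_r \<theta> \<psi> $ 3 = cos \<theta>"
  "e_polar \<theta> \<psi> $ 1 = cos \<theta> * cos \<psi>" "e_polar \<theta> \<psi> $ 2 = cos \<theta> * sin \<psi>" "e_polar \<theta> \<psi> $ 3 = - sin \<theta>"
  "e_azimuth \<psi> $ 1 = - sin \<psi>" "e_azimuth \<psi> $ 2 = cos \<psi>" "e_azimuth \<psi> $ 3 = 0"
  by (simp_all add: e_r_def e_polar_def e_azimuth_def axis_def)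

lemma continuous_on_e_r [continuous_intros]:
  fixes S :: "'a::t2_space set"
  shows "continuous_on S f \<Longrightarrow> continuous_on S g \<Longrightarrow> continuous_on S (\<lambda>x. e_r (f x) (g x))"
  unfolding e_r_def by (intro continuous_intros)

lemma norm_e_r [simp]: "norm (e_r \<theta> \<psi>) = 1"
proof -
  have "(sin \<theta> * cos \<psi>)\<^sup>2 + (sin \<theta> * sin \<psi>)\<^sup>2 + (cos \<theta>)\<^sup>2
    = (sin \<theta>)\<^sup>2 * ((sin \<psi>)\<^sup>2 + (cos \<psi>)\<^sup>2) + (cos \<theta>)\<^sup>2"
    by (simp add: algebra_simps power_mult_distrib del: sin_cos_squared_add sin_cos_squared_add2)
  also have "\<dots> = 1" by simp
  finally show ?thesis
    by (simp add: norm_eq_sqrt_inner inner_vec_def sum_3 power2_eq_square)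
qed

lemma unit_vector_e_r:
  assumes "norm (n :: real^3) = 1"
  obtains \<theta> \<psi> where "0 \<le> \<theta>" "\<theta> \<le> pi" "0 \<le> \<psi>" "\<psi> \<le> 2 * pi" "n = e_r \<theta> \<psi>"
proof -
  have sq: "(n$1)\<^sup>2 + (n$2)\<^sup>2 + (n$3)\<^sup>2 = 1"
    using assms by (simp add: norm_eq_sqrt_inner inner_vec_def sum_3 power2_eq_square)
  define \<theta> where "\<theta> = arccos (n$3)"
  have "(n$3)\<^sup>2 \<le> 1" using sq by (smt (verit) zero_le_power2)
  then have n3: "-1 \<le> n$3" "n$3 \<le> 1" by (auto simp: abs_square_le_1)
  have \<theta>: "0 \<le> \<theta>" "\<theta> \<le> pi" "cos \<theta> = n$3"
    using n3 by (auto simp: \<theta>_def arccos_lbound arccos_ubound)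
  have s: "(sin \<theta>)\<^sup>2 = (n$1)\<^sup>2 + (n$2)\<^sup>2"
    using sq \<theta>(3) sin_squared_eq[of \<theta>] by simp
  obtain \<psi> where \<psi>: "0 \<le> \<psi>" "\<psi> \<le> 2 * pi" "n$1 = sin \<theta> * cos \<psi>" "n$2 = sin \<theta> * sin \<psi>"
  proof (cases "sin \<theta> = 0")
    case True
    then have "n$1 = 0" "n$2 = 0" using s by (auto simp: sum_power2_eq_zero_iff)
    then show ?thesis using True that[of 0] by simp
  next
    case False
    then have "(sin \<theta>)\<^sup>2 / (sin \<theta>)\<^sup>2 = (1::real)" by simp
    then have "(n$1 / sin \<theta>)\<^sup>2 + (n$2 / sin \<theta>)\<^sup>2 = 1"
      unfolding power_divide add_divide_distrib[symmetric] s .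
    then obtain t where "0 \<le> t" "t < 2 * pi" "n$1 / sin \<theta> = cos t" "n$2 / sin \<theta> = sin t"
      using sincos_total_2pi by metis
    then show ?thesis using that[of t] False by (simp add: field_simps)
  qed
  have "n = e_r \<theta> \<psi>" using \<theta> \<psi> by (simp add: vec_eq_iff forall_3)
  then show ?thesis using that \<theta> \<psi> by blast
qed

lemma continuous_on_sphere_integrand:
  assumes "continuous_on UNIV F"
  shows "continuous_on S (\<lambda>q. sin (fst q) * F (e_r (fst q) (snd q)))"
  by (intro continuous_intros continuous_on_compose2[OF assms]) auto

lemma sphere_integrable:
  "continuous_on UNIV F \<Longrightarrow>
    (\<lambda>q. sin (fst q) * F (e_r (fst q) (snd q))) integrable_on cbox (0, 0) (pi, 2 * pi)"
  by (intro integrable_continuous continuous_on_sphere_integrand)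

lemma sphere_integral_cong:
  "(\<And>n. norm n = 1 \<Longrightarrow> F n = G n) \<Longrightarrow> sphere_integral F = sphere_integral G"
  unfolding sphere_integral_def by (intro integral_cong) auto

lemma sphere_integral_add:
  "continuous_on UNIV F \<Longrightarrow> continuous_on UNIV G \<Longrightarrow>
    sphere_integral (\<lambda>n. F n + G n) = sphere_integral F + sphere_integral G"
  unfolding sphere_integral_def
  by (simp add: distrib_left integral_add sphere_integrable)

lemma sphere_integral_cmult: "sphere_integral (\<lambda>n. c * F n) = c * sphere_integral F"
proof -
  have "sphere_integral (\<lambda>n. c * F n) =
    integral (cbox (0, 0) (pi, 2 * pi)) (\<lambda>q. c * (sin (fst q) * F (e_r (fst q) (snd q))))"
    unfolding sphere_integral_def by (intro integral_cong) simp
  then show ?thesis unfolding sphere_integral_def by simp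
qed

lemma sphere_integral_mono:
  assumes "continuous_on UNIV F" "continuous_on UNIV G"
    and "\<And>n. norm n = 1 \<Longrightarrow> F n \<le> G n"
  shows "sphere_integral F \<le> sphere_integral G"
  unfolding sphere_integral_def
  by (intro integral_le sphere_integrable assms mult_left_mono)
     (auto simp: cbox_Pair_eq sin_ge_zero)

lemma sphere_integral_const [simp]: "sphere_integral (\<lambda>n. c) = 4 * pi * c"
proof -
  have i: "integral {0..pi} sin = 2"
  proof (rule integral_unique)
    have "(sin has_integral (- cos pi) - (- cos 0)) {0..pi}"
      by (intro fundamental_theorem_of_calculus)
         (auto intro!: derivative_eq_intros simp flip: has_real_derivative_iff_has_vector_derivative)
    then show "(sin has_integral 2) {0..pi}" by simp
  qed
  have "sphere_integral (\<lambda>n. c) =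
    integral (cbox 0 pi) (\<lambda>x. integral (cbox 0 (2 * pi)) (\<lambda>y. sin x * c))"
    unfolding sphere_integral_def
    by (subst integral_prod_continuous) (auto intro!: continuous_intros)
  also have "\<dots> = integral {0..pi} (\<lambda>x. (2 * pi * c) * sin x)"
    by (simp add: mult_ac)
  also have "\<dots> = 4 * pi * c" using i by simp
  finally show ?thesis .
qed

lemma sphere_integral_nonneg:
  "continuous_on UNIV F \<Longrightarrow> (\<And>n. norm n = 1 \<Longrightarrow> 0 \<le> F n) \<Longrightarrow> 0 \<le> sphere_integral F"
  using sphere_integral_mono[of "\<lambda>_. 0" F] by simp

lemma sphere_integral_abs_le:
  assumes "continuous_on UNIV F" "\<And>n. norm n = 1 \<Longrightarrow> \<bar>F n\<bar> \<le> M"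
  shows "\<bar>sphere_integral F\<bar> \<le> 4 * pi * M"
proof -
  have "F n \<le> M" "- M \<le> F n" if "norm n = 1" for n using assms(2)[OF that] by auto
  then have "sphere_integral F \<le> 4 * pi * M" "4 * pi * (- M) \<le> sphere_integral F"
    using sphere_integral_mono[of F "\<lambda>_. M"] sphere_integral_mono[of "\<lambda>_. - M" F] assms(1) by auto
  then show ?thesis by linarith
qed

text \<open>A nonnegative continuous integrand with integral zero vanishes on the whole rectangle.
  The density sin \<theta> is zero at the poles and hides F there, so F = 0 is first obtained for 0
  < \<theta> < pi and then extended by continuity in \<theta>.\<close>

lemma sphere_integral_eq_0:
  assumes F: "continuous_on UNIV F" "\<And>n. norm n = 1 \<Longrightarrow> 0 \<le> F n"
    and "sphere_integral F = 0" "norm n = 1"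
  shows "F n = 0"
proof -
  obtain \<theta> \<psi> where *: "0 \<le> \<theta>" "\<theta> \<le> pi" "0 \<le> \<psi>" "\<psi> \<le> 2 * pi" "n = e_r \<theta> \<psi>"
    using unit_vector_e_r[OF assms(4)] .
  have "(pi / 2, pi) \<in> box (0, 0) (pi, 2 * pi)" by (auto simp: mem_box Basis_prod_def)
  then have ne: "box (0, 0) (pi, 2 * pi) \<noteq> {}" by blast
  have zero: "\<forall>q\<in>cbox (0, 0) (pi, 2 * pi). sin (fst q) * F (e_r (fst q) (snd q)) = 0"
    using assms(3) unfolding sphere_integral_def
    by (subst (asm) integral_cbox_eq_0_iff[OF continuous_on_sphere_integrand[OF F(1)] ne])
       (auto simp: cbox_Pair_eq sin_ge_zero F)
  then have inner: "F (e_r x \<psi>) = 0" if "x \<in> {0<..<pi}" for x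
  proof -
    have "(x, \<psi>) \<in> cbox (0, 0) (pi, 2 * pi)" using that * by (simp add: cbox_Pair_eq)
    then have "sin x * F (e_r x \<psi>) = 0" using bspec[OF zero] by force
    then show ?thesis using that sin_gt_zero[of x] by simp
  qed
  have "F (e_r \<theta> \<psi>) = 0"
  proof (rule continuous_constant_on_closure[of "{0<..<pi}" "\<lambda>x. F (e_r x \<psi>)"])
    show "continuous_on (closure {0<..<pi}) (\<lambda>x. F (e_r x \<psi>))"
      by (intro continuous_intros continuous_on_compose2[OF F(1)]) auto
  qed (use inner * in auto)
  then show ?thesis using * by simp
qed

section \<open>Jensen's inequality on the sphere\<close>

lemma powr_tangent_line:
  assumes "1 \<le> p" "0 < m" "0 \<le> (x::real)"
  shows "m powr p + p * m powr (p - 1) * (x - m) \<le> x powr p"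
proof (cases "x = 0")
  case True
  have "m powr p = m powr (p - 1) * m" using assms by (simp add: powr_diff)
  then have "m powr p + p * m powr (p - 1) * (x - m) = (1 - p) * m powr p"
    using True by (simp add: algebra_simps)
  also have "\<dots> \<le> 0" using assms by (simp add: mult_nonpos_nonneg)
  finally show ?thesis using True by simp
next
  case False
  have "p * m powr (p - 1) * (x - m) \<le> x powr p - m powr p"
  proof (rule convex_on_imp_above_tangent[of "{0<..}"])
    show "convex_on {0<..} (\<lambda>x. x powr p)" using assms by (rule_tac powr_convex)
    show "((\<lambda>x. x powr p) has_real_derivative p * m powr (p - 1)) (at m within {0<..})"
      using assms by (auto intro!: derivative_eq_intros)
  qed (use assms False in \<open>auto simp: interior_open\<close>)
  then show ?thesis by simp
qed

text \<open>Integrate the tangent inequality for x^p at the average m of |F|: the linear term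
  integrates to zero and 4 pi m^p remains. The case m = 0, where the tangent lemma does not apply,
  is trivial.\<close>

lemma sphere_integral_Jensen:
  assumes F: "continuous_on UNIV F" and p: "1 \<le> p"
  shows "4 * pi * (\<bar>sphere_integral F\<bar> / (4 * pi)) powr p \<le> sphere_integral (\<lambda>n. \<bar>F n\<bar> powr p)"
proof -
  define m where "m = sphere_integral (\<lambda>n. \<bar>F n\<bar>) / (4 * pi)"
  have cont: "continuous_on UNIV (\<lambda>n. \<bar>F n\<bar>)" by (intro continuous_intros F)
  then have cont: "continuous_on UNIV (\<lambda>n. \<bar>F n\<bar>)" "continuous_on UNIV (\<lambda>n. \<bar>F n\<bar> powr p)"
    using p by (auto intro!: continuous_on_powr'[OF _ continuous_on_const])
  have "sphere_integral F \<le> sphere_integral (\<lambda>n. \<bar>F n\<bar>)"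
    by (intro sphere_integral_mono F cont) auto
  moreover have "sphere_integral (\<lambda>n. -1 * F n) \<le> sphere_integral (\<lambda>n. \<bar>F n\<bar>)"
    by (intro sphere_integral_mono continuous_intros F cont) auto
  then have "- sphere_integral F \<le> sphere_integral (\<lambda>n. \<bar>F n\<bar>)"
    unfolding sphere_integral_cmult by simp
  ultimately have le: "\<bar>sphere_integral F\<bar> / (4 * pi) \<le> m"
    by (simp add: m_def divide_right_mono)
  show ?thesis
  proof (cases "m = 0")
    case True
    then have "sphere_integral F = 0" using le pi_gt_zero by (auto simp: divide_le_0_iff)
    then show ?thesis using sphere_integral_nonneg[OF cont(2)] by simp
  next
    case False
    moreover have "0 \<le> m" using sphere_integral_nonneg[OF cont(1)] by (simp add: m_def)
    ultimately have m: "0 < m" by simp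
    have "4 * pi * (\<bar>sphere_integral F\<bar> / (4 * pi)) powr p \<le> 4 * pi * m powr p"
      using le p by (intro mult_left_mono powr_mono2) auto
    also have "\<dots> = sphere_integral (\<lambda>n. (m powr p - p * m powr (p - 1) * m) + p * m powr (p - 1) * \<bar>F n\<bar>)"
    proof -
      have "sphere_integral (\<lambda>n. \<bar>F n\<bar>) = 4 * pi * m" by (simp add: m_def)
      then have "sphere_integral (\<lambda>n. p * m powr (p - 1) * \<bar>F n\<bar>) = 4 * pi * (p * m powr (p - 1) * m)"
        by (simp add: sphere_integral_cmult)
      then show ?thesis
        by (subst sphere_integral_add) (auto intro!: continuous_intros F simp: right_diff_distrib)
    qed
    also have "\<dots> \<le> sphere_integral (\<lambda>n. \<bar>F n\<bar> powr p)"
    proof (rule sphere_integral_mono)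
      fix n show "m powr p - p * m powr (p - 1) * m + p * m powr (p - 1) * \<bar>F n\<bar> \<le> \<bar>F n\<bar> powr p"
        using powr_tangent_line[OF p m, of "\<bar>F n\<bar>"] by (simp add: algebra_simps)
    qed (intro continuous_intros cont)+
    finally show ?thesis .
  qed
qed

lemma sphere_integral_continuous_on_param:
  fixes S :: "'a::t2_space set"
  assumes "continuous_on (S \<times> UNIV) (\<lambda>(s, n). F s n)"
  shows "continuous_on S (\<lambda>s. sphere_integral (F s))"
  unfolding sphere_integral_def
proof (rule integral_continuous_on_param)
  show "continuous_on (S \<times> cbox (0, 0) (pi, 2 * pi)) (\<lambda>(s, q). sin (fst q) * F s (e_r (fst q) (snd q)))"
    unfolding split_beta
    by (intro continuous_intros continuous_on_compose2[OF assms, where f = "\<lambda>x. (fst x, e_r (fst (snd x)) (snd (snd x)))",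
      unfolded split_beta fst_conv snd_conv]) auto
qed

lemma sphere_integral_has_derivative:
  fixes S :: "real set"
  assumes S: "open S" "convex S" "s \<in> S"
    and F: "\<And>s. s \<in> S \<Longrightarrow> continuous_on UNIV (F s)"
    and deriv: "\<And>s n. s \<in> S \<Longrightarrow> norm n = 1 \<Longrightarrow> ((\<lambda>s. F s n) has_real_derivative F' s n) (at s)"
    and F': "continuous_on (S \<times> UNIV) (\<lambda>(s, n). F' s n)"
  shows "((\<lambda>s. sphere_integral (F s)) has_real_derivative sphere_integral (F' s)) (at s)"
proof -
  have "((\<lambda>s. sphere_integral (F s)) has_field_derivative sphere_integral (F' s)) (at s within S)"
    unfolding sphere_integral_def
  proof (rule leibniz_rule_field_derivative)
    show "continuous_on (S \<times> cbox (0, 0) (pi, 2 * pi)) (\<lambda>(s, q). sin (fst q) * F' s (e_r (fst q) (snd q)))"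
      unfolding split_beta
      by (intro continuous_intros continuous_on_compose2[OF F', where f = "\<lambda>x. (fst x, e_r (fst (snd x)) (snd (snd x)))",
        unfolded split_beta fst_conv snd_conv]) auto
  next
    fix s q assume "s \<in> S" and q: "q \<in> cbox (0, 0) (pi, 2 * pi :: real)"
    then show "((\<lambda>s. sin (fst q) * F s (e_r (fst q) (snd q))) has_real_derivative
      sin (fst q) * F' s (e_r (fst q) (snd q))) (at s within S)"
      by (intro DERIV_cmult has_field_derivative_at_within[OF deriv]) auto
  qed (rule S sphere_integrable F | assumption)+
  then show ?thesis using at_within_open[OF S(3,1)] by simp
qed

section \<open>Integration by parts on the sphere\<close>

lemma orthonormal_frame_trace:
  fixes f :: "real^3 \<Rightarrow> real^3"
  assumes "linear f"
  shows "f (e_r \<theta> \<psi>) \<bullet> e_r \<theta> \<psi> + f (e_polar \<theta> \<psi>) \<bullet> e_polar \<theta> \<psi> + f (e_azimuth \<psi>) \<bullet> e_azimuth \<psi>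
    = (\<Sum>i\<in>UNIV. f (axis i 1) \<bullet> axis i 1)"
proof -
  define a where "a i j = f (axis i 1) $ j" for i j
  have f: "f h \<bullet> h = (\<Sum>i\<in>UNIV. \<Sum>j\<in>UNIV. a i j * (h$i * h$j))" for h
  proof -
    have "f h = f (\<Sum>i\<in>UNIV. h$i *\<^sub>R axis i 1)"
      by (simp add: basis_expansion flip: scalar_mult_eq_scaleR)
    also have "\<dots> = (\<Sum>i\<in>UNIV. h$i *\<^sub>R f (axis i 1))"
      by (simp add: linear_sum[OF assms] linear_scale[OF assms])
    finally show ?thesis
      by (simp add: inner_vec_def a_def sum_3 algebra_simps)
  qed
  \<comment> \<open>The projections onto the vectors of an orthonormal frame sum to the identity
    matrix, so the quadratic form of f summed over the frame is its trace.\<close>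
  let ?g = "\<lambda>i j. e_r \<theta> \<psi> $ i * e_r \<theta> \<psi> $ j + e_polar \<theta> \<psi> $ i * e_polar \<theta> \<psi> $ j + e_azimuth \<psi> $ i * e_azimuth \<psi> $ j"
  have s: "sin \<theta> * sin \<theta> = 1 - cos \<theta> * cos \<theta>" "sin \<psi> * sin \<psi> = 1 - cos \<psi> * cos \<psi>"
    using sin_squared_eq[of \<theta>] sin_squared_eq[of \<psi>] by (simp_all add: power2_eq_square)
  have "\<forall>i j. ?g i j = (if i = j then 1 else 0)"
    unfolding forall_3 frame_nth
    by (intro conjI; simp; use s in algebra)
  then have g: "?g i j = (if i = j then 1 else 0)" for i j by blast
  have "f (e_r \<theta> \<psi>) \<bullet> e_r \<theta> \<psi> + f (e_polar \<theta> \<psi>) \<bullet> e_polar \<theta> \<psi> + f (e_azimuth \<psi>) \<bullet> e_azimuth \<psi>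
    = (\<Sum>i\<in>UNIV. \<Sum>j\<in>UNIV. a i j * ?g i j)"
    unfolding f by (simp only: distrib_left sum.distrib)
  also have "\<dots> = (\<Sum>i\<in>UNIV. f (axis i 1) \<bullet> axis i 1)"
    unfolding g by (simp add: a_def inner_axis sum_3)
  finally show ?thesis .
qed

lemma e_r_has_derivative_polar: "((\<lambda>\<theta>. e_r \<theta> \<psi>) has_vector_derivative e_polar \<theta> \<psi>) (at \<theta> within S)"
  unfolding e_r_def e_polar_def by (auto intro!: derivative_eq_intros)

lemma e_polar_has_derivative_polar: "((\<lambda>\<theta>. e_polar \<theta> \<psi>) has_vector_derivative - e_r \<theta> \<psi>) (at \<theta> within S)"
  unfolding e_r_def e_polar_def by (auto intro!: derivative_eq_intros simp: algebra_simps)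

lemma e_r_has_derivative_azimuth: "((\<lambda>\<psi>. e_r \<theta> \<psi>) has_vector_derivative sin \<theta> *\<^sub>R e_azimuth \<psi>) (at \<psi> within S)"
  unfolding e_r_def e_azimuth_def by (auto intro!: derivative_eq_intros simp: algebra_simps)

text \<open>The derivative is the horizontal unit vector pointing towards the polar axis and does
  not depend on \<theta>. It is resolved in the frame at an arbitrary \<theta> so that it produces
  the same products with \<open>e_r\<close> and \<open>e_polar\<close> as the polar
  derivative.\<close>

lemma e_azimuth_has_derivative_azimuth:
  "(e_azimuth has_vector_derivative - (sin \<theta> *\<^sub>R e_r \<theta> \<psi> + cos \<theta> *\<^sub>R e_polar \<theta> \<psi>)) (at \<psi> within S)"
proof -
  have "- (sin \<theta> *\<^sub>R e_r \<theta> \<psi> + cos \<theta> *\<^sub>R e_polar \<theta> \<psi>) = (- cos \<psi>) *\<^sub>R axis 1 1 + (- sin \<psi>) *\<^sub>R axis 2 1"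
    using sin_squared_eq[of \<theta>]
    by (simp add: vec_eq_iff forall_3 axis_def power2_eq_square) algebra
  then show ?thesis
    unfolding e_azimuth_def by (auto intro!: derivative_eq_intros simp: algebra_simps)
qed

text \<open>The surface divergence of the tangential part of \<open>X\<close> is \<open>div X - X' n n \<bullet> n - 2 (X n \<bullet> n)\<close>
  on the unit sphere. In spherical coordinates, multiplied by \<open>sin \<theta>\<close>, it is the sum of a
  \<open>\<theta>\<close>-derivative and a \<open>\<psi>\<close>-derivative.\<close>

lemma sphere_integral_surface_divergence:
  fixes X :: "real^3 \<Rightarrow> real^3"
  assumes X: "\<And>n. (X has_derivative X' n) (at n)"
    and cont: "\<And>h. continuous_on UNIV (\<lambda>n. X' n h)"
  shows "sphere_integral (\<lambda>n. (\<Sum>i\<in>UNIV. X' n (axis i 1) \<bullet> axis i 1) - X' n n \<bullet> n - 2 * (X n \<bullet> n)) = 0"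
proof -
  let ?box = "cbox (0, 0) (pi, 2 * pi) :: (real \<times> real) set"
  have lin: "linear (X' n)" for n using X has_derivative_linear by blast
  \<comment> \<open>Continuity of X' is given for fixed directions only; the frame vectors move with
    the point, so they are expanded in the standard basis.\<close>
  have X'_eq: "X' n h = (\<Sum>i\<in>UNIV. h$i *\<^sub>R X' n (axis i 1))" for n h
  proof -
    have "X' n h = X' n (\<Sum>i\<in>UNIV. h$i *\<^sub>R axis i 1)"
      by (simp add: basis_expansion flip: scalar_mult_eq_scaleR)
    then show ?thesis by (simp add: linear_sum[OF lin] linear_scale[OF lin])
  qed
  have X_cont: "continuous_on UNIV X"
    using X by (auto intro: has_derivative_continuous_on)
  \<comment> \<open>A is the \<theta>-derivative of sin \<theta> times the \<open>e_polar\<close>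
    component of X, and B the \<psi>-derivative of its \<open>e_azimuth\<close> component; the cos
    \<theta> terms cancel in A + B. The boundary terms vanish for A because sin 0 = sin pi = 0, and
    for B by periodicity in \<psi>.\<close>
  define A where "A \<theta> \<psi> = sin \<theta> * (X' (e_r \<theta> \<psi>) (e_polar \<theta> \<psi>) \<bullet> e_polar \<theta> \<psi> - X (e_r \<theta> \<psi>) \<bullet> e_r \<theta> \<psi>)
    + cos \<theta> * (X (e_r \<theta> \<psi>) \<bullet> e_polar \<theta> \<psi>)" for \<theta> \<psi>
  define B where "B \<theta> \<psi> = sin \<theta> * (X' (e_r \<theta> \<psi>) (e_azimuth \<psi>) \<bullet> e_azimuth \<psi> - X (e_r \<theta> \<psi>) \<bullet> e_r \<theta> \<psi>)
    - cos \<theta> * (X (e_r \<theta> \<psi>) \<bullet> e_polar \<theta> \<psi>)" for \<theta> \<psi>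
  have polar_cont: "continuous_on S (\<lambda>q. e_polar (fst q) (snd q))"
    and azimuth_cont: "continuous_on S (\<lambda>q. e_azimuth (snd q))" for S :: "(real \<times> real) set"
    unfolding e_polar_def e_azimuth_def by (intro continuous_intros)+
  have comp: "continuous_on ?box (\<lambda>q. H (e_r (fst q) (snd q)))" if "continuous_on UNIV H" for H :: "real^3 \<Rightarrow> real^3"
    by (intro continuous_on_compose2[OF that] continuous_intros) auto
  have X'_cont: "continuous_on ?box (\<lambda>q. X' (e_r (fst q) (snd q)) (k q))"
    if "continuous_on ?box k" for k
    unfolding X'_eq[where h = "k _"] by (intro continuous_intros that comp cont)
  have A_cont: "continuous_on ?box (\<lambda>q. A (fst q) (snd q))"
    and B_cont: "continuous_on ?box (\<lambda>q. B (fst q) (snd q))"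
    unfolding A_def B_def by (intro continuous_intros X'_cont polar_cont azimuth_cont comp X_cont)+
  have A_int: "integral ?box (\<lambda>q. A (fst q) (snd q)) = 0"
  proof -
    have "integral ?box (\<lambda>q. A (fst q) (snd q))
      = integral (cbox 0 (2 * pi)) (\<lambda>\<psi>. integral (cbox 0 pi) (\<lambda>\<theta>. A \<theta> \<psi>))"
      using integral_prod_continuous[OF A_cont] integral_swap_continuous[of 0 0 pi "2 * pi" A] A_cont
      by (simp add: split_beta)
    also have "\<dots> = integral (cbox 0 (2 * pi)) (\<lambda>\<psi>. 0)"
    proof (rule integral_cong)
      fix \<psi> :: real
      have "((\<lambda>\<theta>. A \<theta> \<psi>) has_integral
        sin pi * (X (e_r pi \<psi>) \<bullet> e_polar pi \<psi>) - sin 0 * (X (e_r 0 \<psi>) \<bullet> e_polar 0 \<psi>)) {0..pi}"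
      proof (rule fundamental_theorem_of_calculus)
        fix \<theta> assume "\<theta> \<in> {0..pi}"
        have "((\<lambda>\<theta>. X (e_r \<theta> \<psi>)) has_vector_derivative X' (e_r \<theta> \<psi>) (e_polar \<theta> \<psi>)) (at \<theta> within {0..pi})"
          using vector_derivative_diff_chain_within[OF e_r_has_derivative_polar has_derivative_at_withinI[OF X]]
          by (simp add: o_def)
        from bounded_bilinear.has_vector_derivative[OF bounded_bilinear_inner this e_polar_has_derivative_polar]
        have "((\<lambda>\<theta>. sin \<theta> * (X (e_r \<theta> \<psi>) \<bullet> e_polar \<theta> \<psi>)) has_vector_derivative
          sin \<theta> * (X (e_r \<theta> \<psi>) \<bullet> - e_r \<theta> \<psi> + X' (e_r \<theta> \<psi>) (e_polar \<theta> \<psi>) \<bullet> e_polar \<theta> \<psi>)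
          + cos \<theta> * (X (e_r \<theta> \<psi>) \<bullet> e_polar \<theta> \<psi>)) (at \<theta> within {0..pi})"
          by (intro has_vector_derivative_mult)
             (auto intro!: derivative_eq_intros simp flip: has_real_derivative_iff_has_vector_derivative)
        then show "((\<lambda>\<theta>. sin \<theta> * (X (e_r \<theta> \<psi>) \<bullet> e_polar \<theta> \<psi>)) has_vector_derivative A \<theta> \<psi>) (at \<theta> within {0..pi})"
          by (simp add: A_def)
      qed simp
      then show "integral (cbox 0 pi) (\<lambda>\<theta>. A \<theta> \<psi>) = 0" by (simp add: integral_unique)
    qed
    finally show ?thesis by simp
  qed
  have B_int: "integral ?box (\<lambda>q. B (fst q) (snd q)) = 0"
  proof -
    have "integral ?box (\<lambda>q. B (fst q) (snd q))
      = integral (cbox 0 pi) (\<lambda>\<theta>. integral (cbox 0 (2 * pi)) (\<lambda>\<psi>. B \<theta> \<psi>))"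
      using integral_prod_continuous[OF B_cont] by simp
    also have "\<dots> = integral (cbox 0 pi) (\<lambda>\<theta>. 0)"
    proof (rule integral_cong)
      fix \<theta> :: real
      have "((\<lambda>\<psi>. B \<theta> \<psi>) has_integral
        X (e_r \<theta> (2 * pi)) \<bullet> e_azimuth (2 * pi) - X (e_r \<theta> 0) \<bullet> e_azimuth 0) {0..2 * pi}"
      proof (rule fundamental_theorem_of_calculus)
        fix \<psi> assume "\<psi> \<in> {0..2 * pi}"
        have "((\<lambda>\<psi>. X (e_r \<theta> \<psi>)) has_vector_derivative X' (e_r \<theta> \<psi>) (sin \<theta> *\<^sub>R e_azimuth \<psi>)) (at \<psi> within {0..2 * pi})"
          using vector_derivative_diff_chain_within[OF e_r_has_derivative_azimuth has_derivative_at_withinI[OF X]]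
          by (simp add: o_def)
        from bounded_bilinear.has_vector_derivative[OF bounded_bilinear_inner this
          e_azimuth_has_derivative_azimuth[of \<theta>]]
        show "((\<lambda>\<psi>. X (e_r \<theta> \<psi>) \<bullet> e_azimuth \<psi>) has_vector_derivative B \<theta> \<psi>) (at \<psi> within {0..2 * pi})"
          by (simp add: B_def linear_scale[OF lin] inner_add_right algebra_simps)
      qed simp
      moreover have "e_r \<theta> (2 * pi) = e_r \<theta> 0" "e_azimuth (2 * pi) = e_azimuth 0"
        by (simp_all add: e_r_def e_azimuth_def)
      ultimately show "integral (cbox 0 (2 * pi)) (\<lambda>\<psi>. B \<theta> \<psi>) = 0" by (simp add: integral_unique)
    qed
    finally show ?thesis by simp
  qed
  have "sphere_integral (\<lambda>n. (\<Sum>i\<in>UNIV. X' n (axis i 1) \<bullet> axis i 1) - X' n n \<bullet> n - 2 * (X n \<bullet> n))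
    = integral ?box (\<lambda>q. A (fst q) (snd q) + B (fst q) (snd q))"
    unfolding sphere_integral_def
  proof (rule integral_cong)
    fix q :: "real \<times> real"
    show "sin (fst q) * ((\<Sum>i\<in>UNIV. X' (e_r (fst q) (snd q)) (axis i 1) \<bullet> axis i 1)
        - X' (e_r (fst q) (snd q)) (e_r (fst q) (snd q)) \<bullet> e_r (fst q) (snd q)
        - 2 * (X (e_r (fst q) (snd q)) \<bullet> e_r (fst q) (snd q)))
      = A (fst q) (snd q) + B (fst q) (snd q)"
      unfolding orthonormal_frame_trace[OF lin, of _ "fst q" "snd q", symmetric] A_def B_def
      by (simp add: algebra_simps)
  qed
  also have "\<dots> = 0"
    using A_int B_int A_cont B_cont by (simp add: integral_add integrable_continuous)
  finally show ?thesis .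
qed

section \<open>Gradients of twice differentiable functions\<close>

text \<open>Replaces the families of partial derivatives by a gradient field G and the Hessian as
  the linear map \<open>N z\<close>. Continuity of the Hessian direction by direction is enough,
  since the directions span a finite-dimensional space.\<close>

lemma C_class_on_2_gradient:
  assumes "C_class_on 2 S u"
  obtains G N where
    "\<And>z. z \<in> S \<Longrightarrow> (u has_derivative (\<lambda>h. G z \<bullet> h)) (at z within S)"
    "\<And>z. z \<in> S \<Longrightarrow> (G has_derivative N z) (at z within S)"
    "\<And>h. continuous_on S (\<lambda>z. N z h)"
proof -
  obtain D where D: "\<And>z. z \<in> S \<Longrightarrow> (u has_derivative (\<lambda>h. \<Sum>b\<in>Basis. (h \<bullet> b) * D b z)) (at z within S)"
    and "\<forall>b\<in>Basis. C_class_on 1 S (D b)"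
    using assms by (auto simp: numeral_2_eq_2)
  then have "\<forall>b\<in>Basis. \<exists>E. (\<forall>z\<in>S. (D b has_derivative (\<lambda>h. \<Sum>c\<in>Basis. (h \<bullet> c) * E c z)) (at z within S))
      \<and> (\<forall>c\<in>Basis. continuous_on S (E c))"
    by simp
  from bchoice[OF this] obtain E where E: "\<And>b z. b \<in> Basis \<Longrightarrow> z \<in> S \<Longrightarrow>
      (D b has_derivative (\<lambda>h. \<Sum>c\<in>Basis. (h \<bullet> c) * E b c z)) (at z within S)"
    and cont: "\<And>b c. b \<in> Basis \<Longrightarrow> c \<in> Basis \<Longrightarrow> continuous_on S (E b c)"
    by blast
  show ?thesis
  proof (rule that[of "\<lambda>z. \<Sum>b\<in>Basis. D b z *\<^sub>R b" "\<lambda>z h. \<Sum>b\<in>Basis. (\<Sum>c\<in>Basis. (h \<bullet> c) * E b c z) *\<^sub>R b"])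
    fix z assume z: "z \<in> S"
    have "(\<lambda>h. (\<Sum>b\<in>Basis. D b z *\<^sub>R b) \<bullet> h) = (\<lambda>h. \<Sum>b\<in>Basis. (h \<bullet> b) * D b z)"
      by (rule ext, subst inner_commute) (simp add: inner_sum_right mult.commute)
    then show "(u has_derivative (\<lambda>h. (\<Sum>b\<in>Basis. D b z *\<^sub>R b) \<bullet> h)) (at z within S)"
      using D[OF z] by simp
    show "((\<lambda>z. \<Sum>b\<in>Basis. D b z *\<^sub>R b) has_derivative
      (\<lambda>h. \<Sum>b\<in>Basis. (\<Sum>c\<in>Basis. (h \<bullet> c) * E b c z) *\<^sub>R b)) (at z within S)"
      by (intro has_derivative_sum has_derivative_scaleR_left E z)
  next
    fix h :: 'a
    show "continuous_on S (\<lambda>z. \<Sum>b\<in>Basis. (\<Sum>c\<in>Basis. (h \<bullet> c) * E b c z) *\<^sub>R b)"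
      by (intro continuous_intros cont)
  qed
qed

lemma has_real_derivative_along_line:
  fixes u :: "'a::euclidean_space \<Rightarrow> real"
  assumes "(u has_derivative (\<lambda>h. g \<bullet> h)) (at (z + s *\<^sub>R b))"
  shows "((\<lambda>s. u (z + s *\<^sub>R b)) has_real_derivative g \<bullet> b) (at s)"
proof -
  have "((\<lambda>s. z + s *\<^sub>R b) has_vector_derivative b) (at s)"
    by (auto intro!: derivative_eq_intros)
  from vector_derivative_diff_chain_within[OF this has_derivative_at_withinI[OF assms]]
  show ?thesis by (simp add: o_def has_real_derivative_iff_has_vector_derivative)
qed

lemma gradient_has_derivative_along_line:
  fixes G :: "'a::euclidean_space \<Rightarrow> 'a"
  assumes "(G has_derivative M) (at (z + s *\<^sub>R b))"
  shows "((\<lambda>s. G (z + s *\<^sub>R b) \<bullet> k) has_real_derivative M b \<bullet> k) (at s)"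
proof -
  have "((\<lambda>s. z + s *\<^sub>R b) has_vector_derivative b) (at s)"
    by (auto intro!: derivative_eq_intros)
  from vector_derivative_diff_chain_within[OF this has_derivative_at_withinI[OF assms]]
  have "((\<lambda>s. G (z + s *\<^sub>R b)) has_vector_derivative M b) (at s)" by (simp add: o_def)
  from bounded_linear.has_vector_derivative[OF bounded_linear_inner_left this]
  show ?thesis by (simp add: has_real_derivative_iff_has_vector_derivative)
qed

lemma second_partial_eq:
  fixes u :: "'a::euclidean_space \<Rightarrow> real"
  assumes S: "open S" "z \<in> S"
    and u: "\<And>z. z \<in> S \<Longrightarrow> (u has_derivative (\<lambda>h. G z \<bullet> h)) (at z)"
    and G: "(G has_derivative M) (at z)"
  shows "second_partial b u z = M b \<bullet> b"
proof -
  have "open ((\<lambda>s. z + s *\<^sub>R b) -` S)" by (intro open_vimage S continuous_intros)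
  then have "eventually (\<lambda>s. s \<in> (\<lambda>s. z + s *\<^sub>R b) -` S) (nhds 0)"
    using S by (intro eventually_nhds_in_open) auto
  then have "eventually (\<lambda>s. z + s *\<^sub>R b \<in> S) (nhds 0)" by simp
  then have "eventually (\<lambda>s. deriv (\<lambda>s. u (z + s *\<^sub>R b)) s = G (z + s *\<^sub>R b) \<bullet> b) (nhds 0)"
    by eventually_elim (intro DERIV_imp_deriv has_real_derivative_along_line u)
  then have "second_partial b u z = deriv (\<lambda>s. G (z + s *\<^sub>R b) \<bullet> b) 0"
    unfolding second_partial_def by (intro deriv_cong_ev) auto
  also have "\<dots> = M b \<bullet> b"
    using G by (intro DERIV_imp_deriv gradient_has_derivative_along_line) simp
  finally show ?thesis .
qed

text \<open>Two applications of the mean value theorem, first along h and then along k. The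
  left-hand side is symmetric in h and k, whereas the order of differentiation on the right is not;
  this is what yields symmetry of the Hessian.\<close>

lemma second_difference:
  fixes u :: "'a::euclidean_space \<Rightarrow> real"
  assumes u: "\<And>z. z \<in> S \<Longrightarrow> (u has_derivative (\<lambda>h. G z \<bullet> h)) (at z)"
    and G: "\<And>z. z \<in> S \<Longrightarrow> (G has_derivative N z) (at z)"
    and \<epsilon>: "0 < \<epsilon>" and S: "\<And>s t. 0 \<le> s \<Longrightarrow> s \<le> \<epsilon> \<Longrightarrow> 0 \<le> t \<Longrightarrow> t \<le> \<epsilon> \<Longrightarrow> z + s *\<^sub>R h + t *\<^sub>R k \<in> S"
  obtains s t where "0 \<le> s" "s \<le> \<epsilon>" "0 \<le> t" "t \<le> \<epsilon>"
    "u (z + \<epsilon> *\<^sub>R h + \<epsilon> *\<^sub>R k) - u (z + \<epsilon> *\<^sub>R h) - u (z + \<epsilon> *\<^sub>R k) + u z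
      = \<epsilon>\<^sup>2 * (N (z + s *\<^sub>R h + t *\<^sub>R k) k \<bullet> h)"
proof -
  define F where "F s = u ((z + \<epsilon> *\<^sub>R k) + s *\<^sub>R h) - u (z + s *\<^sub>R h)" for s
  have F: "(F has_real_derivative (G ((z + \<epsilon> *\<^sub>R k) + s *\<^sub>R h) \<bullet> h - G (z + s *\<^sub>R h) \<bullet> h)) (at s)"
    if "0 \<le> s" "s \<le> \<epsilon>" for s
    unfolding F_def using S[of s \<epsilon>] S[of s 0] that \<epsilon>
    by (intro DERIV_diff has_real_derivative_along_line u) (auto simp: algebra_simps)
  obtain s where s: "0 < s" "s < \<epsilon>"
    "F \<epsilon> - F 0 = (\<epsilon> - 0) * (G ((z + \<epsilon> *\<^sub>R k) + s *\<^sub>R h) \<bullet> h - G (z + s *\<^sub>R h) \<bullet> h)"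
    using MVT2[OF \<epsilon> F] by blast
  have G': "((\<lambda>t. G ((z + s *\<^sub>R h) + t *\<^sub>R k) \<bullet> h) has_real_derivative N ((z + s *\<^sub>R h) + t *\<^sub>R k) k \<bullet> h) (at t)"
    if "0 \<le> t" "t \<le> \<epsilon>" for t
    using S[of s t] s that by (intro gradient_has_derivative_along_line G) auto
  obtain t where t: "0 < t" "t < \<epsilon>"
    "G ((z + s *\<^sub>R h) + \<epsilon> *\<^sub>R k) \<bullet> h - G ((z + s *\<^sub>R h) + 0 *\<^sub>R k) \<bullet> h
      = (\<epsilon> - 0) * (N ((z + s *\<^sub>R h) + t *\<^sub>R k) k \<bullet> h)"
    using MVT2[OF \<epsilon> G'] by blast
  have "F \<epsilon> - F 0 = \<epsilon>\<^sup>2 * (N (z + s *\<^sub>R h + t *\<^sub>R k) k \<bullet> h)"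
    using s(3) t(3) by (simp add: power2_eq_square algebra_simps)
  moreover have "F \<epsilon> - F 0 = u (z + \<epsilon> *\<^sub>R h + \<epsilon> *\<^sub>R k) - u (z + \<epsilon> *\<^sub>R h) - u (z + \<epsilon> *\<^sub>R k) + u z"
    by (simp add: F_def algebra_simps)
  ultimately show ?thesis using that[of s t] s t by simp
qed

lemma second_derivative_symmetric:
  fixes u :: "'a::euclidean_space \<Rightarrow> real"
  assumes S: "open S" "z \<in> S"
    and u: "\<And>z. z \<in> S \<Longrightarrow> (u has_derivative (\<lambda>h. G z \<bullet> h)) (at z)"
    and G: "\<And>z. z \<in> S \<Longrightarrow> (G has_derivative N z) (at z)"
    and N: "\<And>h. continuous_on S (\<lambda>z. N z h)"
  shows "N z h \<bullet> k = N z k \<bullet> h"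
proof -
  have "\<bar>N z h \<bullet> k - N z k \<bullet> h\<bar> \<le> 2 * e" if e: "0 < e" for e
  proof -
    have "continuous_on S (\<lambda>z. N z h \<bullet> k)" "continuous_on S (\<lambda>z. N z k \<bullet> h)"
      by (intro continuous_intros N)+
    then have "isCont (\<lambda>z. N z h \<bullet> k) z" "isCont (\<lambda>z. N z k \<bullet> h) z"
      using S by (auto simp: continuous_on_eq_continuous_at)
    then obtain d1 d2 where "0 < d1" "\<And>y. dist y z < d1 \<Longrightarrow> \<bar>N y h \<bullet> k - N z h \<bullet> k\<bar> < e"
      and "0 < d2" "\<And>y. dist y z < d2 \<Longrightarrow> \<bar>N y k \<bullet> h - N z k \<bullet> h\<bar> < e"
      unfolding continuous_at_eps_delta dist_real_def using e by metis
    moreover obtain d3 where "0 < d3" "\<And>y. dist y z < d3 \<Longrightarrow> y \<in> S"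
      using S unfolding open_dist by blast
    ultimately have "\<exists>d>0. \<forall>y. dist y z < d \<longrightarrow>
        y \<in> S \<and> \<bar>N y h \<bullet> k - N z h \<bullet> k\<bar> < e \<and> \<bar>N y k \<bullet> h - N z k \<bullet> h\<bar> < e"
      by (intro exI[of _ "min d1 (min d2 d3)"]) simp
    then obtain d where d: "0 < d" "\<And>y. dist y z < d \<Longrightarrow>
        y \<in> S \<and> \<bar>N y h \<bullet> k - N z h \<bullet> k\<bar> < e \<and> \<bar>N y k \<bullet> h - N z k \<bullet> h\<bar> < e"
      by blast
    define c where "c = norm h + norm k + 1"
    have c: "0 < c" unfolding c_def by (smt (verit) norm_ge_zero)
    \<comment> \<open>Small enough for the whole parallelogram spanned by \<epsilon> h and
      \<epsilon> k to stay within distance d of z.\<close>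
    define \<epsilon> where "\<epsilon> = d / 2 / c"
    have \<epsilon>: "0 < \<epsilon>" using d c by (simp add: \<epsilon>_def)
    have near: "dist (z + s *\<^sub>R h + t *\<^sub>R k) z < d" if "0 \<le> s" "s \<le> \<epsilon>" "0 \<le> t" "t \<le> \<epsilon>" for s t
    proof -
      have "dist (z + s *\<^sub>R h + t *\<^sub>R k) z = norm (s *\<^sub>R h + t *\<^sub>R k)" by (simp add: dist_norm)
      also have "\<dots> \<le> s * norm h + t * norm k" using norm_triangle_ineq[of "s *\<^sub>R h" "t *\<^sub>R k"] that by simp
      also have "\<dots> \<le> \<epsilon> * norm h + \<epsilon> * norm k" using that by (intro add_mono mult_right_mono) auto
      also have "\<dots> \<le> \<epsilon> * c" using \<epsilon> by (simp add: c_def algebra_simps)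
      also have "\<dots> < d" using c d by (simp add: \<epsilon>_def)
      finally show ?thesis .
    qed
    have near': "dist (z + s *\<^sub>R k + t *\<^sub>R h) z < d" if "0 \<le> s" "s \<le> \<epsilon>" "0 \<le> t" "t \<le> \<epsilon>" for s t
      using near[of t s] that by (simp add: add_ac)
    obtain p where p: "dist p z < d"
      "u (z + \<epsilon> *\<^sub>R h + \<epsilon> *\<^sub>R k) - u (z + \<epsilon> *\<^sub>R h) - u (z + \<epsilon> *\<^sub>R k) + u z = \<epsilon>\<^sup>2 * (N p k \<bullet> h)"
    proof (rule second_difference[where z = z and h = h and k = k, OF u G \<epsilon>])
      fix s t assume *: "0 \<le> s" "s \<le> \<epsilon>" "0 \<le> t" "t \<le> \<epsilon>"
        "u (z + \<epsilon> *\<^sub>R h + \<epsilon> *\<^sub>R k) - u (z + \<epsilon> *\<^sub>R h) - u (z + \<epsilon> *\<^sub>R k) + u z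
          = \<epsilon>\<^sup>2 * (N (z + s *\<^sub>R h + t *\<^sub>R k) k \<bullet> h)"
      show thesis by (rule that[OF near[OF *(1-4)] *(5)])
    qed (use near d in blast)+
    obtain q where q: "dist q z < d"
      "u (z + \<epsilon> *\<^sub>R k + \<epsilon> *\<^sub>R h) - u (z + \<epsilon> *\<^sub>R k) - u (z + \<epsilon> *\<^sub>R h) + u z = \<epsilon>\<^sup>2 * (N q h \<bullet> k)"
    proof (rule second_difference[where z = z and h = k and k = h, OF u G \<epsilon>])
      fix s t assume *: "0 \<le> s" "s \<le> \<epsilon>" "0 \<le> t" "t \<le> \<epsilon>"
        "u (z + \<epsilon> *\<^sub>R k + \<epsilon> *\<^sub>R h) - u (z + \<epsilon> *\<^sub>R k) - u (z + \<epsilon> *\<^sub>R h) + u z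
          = \<epsilon>\<^sup>2 * (N (z + s *\<^sub>R k + t *\<^sub>R h) h \<bullet> k)"
      show thesis by (rule that[OF near'[OF *(1-4)] *(5)])
    qed (use near' d in blast)+
    have "\<epsilon>\<^sup>2 * (N p k \<bullet> h) = \<epsilon>\<^sup>2 * (N q h \<bullet> k)" using p(2) q(2) by (simp add: algebra_simps)
    then have "N p k \<bullet> h = N q h \<bullet> k" using \<epsilon> by simp
    then show ?thesis using d(2)[OF p(1)] d(2)[OF q(1)] by linarith
  qed
  then have "\<bar>N z h \<bullet> k - N z k \<bullet> h\<bar> \<le> 0 + e" if "0 < e" for e
    using that half_gt_zero[OF that] by fastforce
  then have "\<bar>N z h \<bullet> k - N z k \<bullet> h\<bar> \<le> 0" by (rule field_le_epsilon)
  then show ?thesis by simp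
qed

section \<open>Spherical means of solutions of the wave equation\<close>

abbreviation (input) upper_half :: "((real^3) \<times> real) set" where
  "upper_half \<equiv> UNIV \<times> {0..}"

text \<open>The derivatives are taken within the closed half-space, so that G exists and is
  continuous up to t = 0; the characteristic derivatives below can then be started from the initial
  data.\<close>

locale wave_solution =
  fixes u :: "(real^3) \<times> real \<Rightarrow> real" and G :: "(real^3) \<times> real \<Rightarrow> (real^3) \<times> real"
    and N :: "(real^3) \<times> real \<Rightarrow> (real^3) \<times> real \<Rightarrow> (real^3) \<times> real" and \<phi> :: "real \<Rightarrow> real"
  assumes u_deriv: "\<And>z. z \<in> upper_half \<Longrightarrow> (u has_derivative (\<lambda>h. G z \<bullet> h)) (at z within upper_half)"
    and G_deriv: "\<And>z. z \<in> upper_half \<Longrightarrow> (G has_derivative N z) (at z within upper_half)"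
    and N_cont: "\<And>h. continuous_on upper_half (\<lambda>z. N z h)"
    and \<phi>_cont: "continuous_on UNIV \<phi>"
    and wave: "\<And>x t. 0 < t \<Longrightarrow> dAlembertian u (x, t) = \<phi> (u (x, t))"
begin

lemma u_cont: "continuous_on upper_half u"
  using u_deriv by (rule has_derivative_continuous_on)

lemma G_cont: "continuous_on upper_half G"
  using G_deriv by (rule has_derivative_continuous_on)

lemma at_within_upper_half: "0 < t \<Longrightarrow> at (x, t) within upper_half = at (x, t)"
proof (rule at_within_interior)
  assume "0 < t"
  then show "(x, t) \<in> interior upper_half"
    by (simp add: interior_Times interior_real_atLeast)
qed

lemma u_deriv_at: "0 < t \<Longrightarrow> (u has_derivative (\<lambda>h. G (x, t) \<bullet> h)) (at (x, t))"
  using u_deriv[of "(x, t)"] at_within_upper_half by simp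

lemma G_deriv_at: "0 < t \<Longrightarrow> (G has_derivative N (x, t)) (at (x, t))"
  using G_deriv[of "(x, t)"] at_within_upper_half by simp

lemma open_upper_half: "open (UNIV \<times> {0<..} :: ((real^3) \<times> real) set)"
  by (intro open_Times) auto

text \<open>Needed to cancel the mixed time-radius derivatives when the two null derivatives are
  composed.\<close>

lemma N_symmetric:
  assumes "0 < t"
  shows "N (x, t) h \<bullet> k = N (x, t) k \<bullet> h"
proof (rule second_derivative_symmetric[OF open_upper_half, where u = u and G = G])
  show "continuous_on (UNIV \<times> {0<..}) (\<lambda>z. N z h)" for h
    by (rule continuous_on_subset[OF N_cont]) auto
qed (use assms u_deriv_at G_deriv_at in auto)

lemma wave_N:
  assumes "0 < t"
  shows "N (x, t) (0, 1) \<bullet> (0, 1) - (\<Sum>i\<in>UNIV. N (x, t) (axis i 1, 0) \<bullet> (axis i 1, 0)) = \<phi> (u (x, t))"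
proof -
  have "second_partial b u (x, t) = N (x, t) b \<bullet> b" for b
    using assms u_deriv_at G_deriv_at by (intro second_partial_eq[OF open_upper_half]) auto
  then show ?thesis using wave[OF assms, of x] by (simp add: dAlembertian_def)
qed

lemma N_linear: "z \<in> upper_half \<Longrightarrow> linear (N z)"
  using G_deriv has_derivative_linear by blast

text \<open>Transfers the continuity of N in fixed directions to directions that vary with the point
  on the sphere.\<close>

lemma N_Pair:
  assumes "z \<in> upper_half"
  shows "N z (n, c) = (\<Sum>i\<in>UNIV. n$i *\<^sub>R N z (axis i 1, 0)) + c *\<^sub>R N z (0, 1)"
proof -
  have "(n, c) = (\<Sum>i\<in>UNIV. n$i *\<^sub>R (axis i 1, 0)) + c *\<^sub>R (0, 1)"
    by (simp add: prod_eq_iff fst_sum snd_sum basis_expansion flip: scalar_mult_eq_scaleR)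
  then show ?thesis
    by (metis (no_types, lifting) linear_add[OF N_linear[OF assms]] linear_scale[OF N_linear[OF assms]]
        linear_sum[OF N_linear[OF assms]] sum.cong)
qed

text \<open>This is 4 pi times the average over the sphere of radius r about x.\<close>

definition mean :: "real^3 \<Rightarrow> real \<Rightarrow> real \<Rightarrow> real" where
  "mean x r t = sphere_integral (\<lambda>n. u (x + r *\<^sub>R n, t))"

definition source_mean :: "real^3 \<Rightarrow> real \<Rightarrow> real \<Rightarrow> real" where
  "source_mean x r t = sphere_integral (\<lambda>n. \<phi> (u (x + r *\<^sub>R n, t)))"

text \<open>For \<open>\<kappa> = \<plusminus>1\<close> this is the characteristic derivative \<open>\<partial>\<^sub>t - \<kappa> \<partial>\<^sub>r\<close> of \<open>r \<cdot> mean x r t\<close>.\<close>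

definition char_deriv :: "real \<Rightarrow> real^3 \<Rightarrow> real \<Rightarrow> real \<Rightarrow> real" where
  "char_deriv \<kappa> x r t = sphere_integral (\<lambda>n. r * (G (x + r *\<^sub>R n, t) \<bullet> (- \<kappa> *\<^sub>R n, 1)) - \<kappa> * u (x + r *\<^sub>R n, t))"

lemma comp_cont:
  fixes S :: "'a::t2_space set"
  assumes "continuous_on upper_half F" "continuous_on S f" "continuous_on S g" "continuous_on S k"
    and "\<And>s. s \<in> S \<Longrightarrow> 0 \<le> g s"
  shows "continuous_on S (\<lambda>s. F (x + f s *\<^sub>R k s, g s))"
  by (rule continuous_on_compose2[OF assms(1)]) (use assms in \<open>auto intro!: continuous_intros\<close>)

lemma comp_cont_sphere:
  "continuous_on upper_half F \<Longrightarrow> 0 \<le> t \<Longrightarrow> continuous_on UNIV (\<lambda>n. F (x + r *\<^sub>R n, t))"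
  by (rule comp_cont) (auto intro!: continuous_intros)

lemma \<phi>_u_cont: "continuous_on upper_half (\<lambda>z. \<phi> (u z))"
  by (rule continuous_on_compose2[OF \<phi>_cont u_cont]) auto

lemma mean_cont: "continuous_on (UNIV \<times> {0..}) (\<lambda>(r, t). mean x r t)"
proof -
  have "continuous_on (UNIV \<times> {0..}) (\<lambda>q. sphere_integral (\<lambda>n. u (x + fst q *\<^sub>R n, snd q)))"
    by (rule sphere_integral_continuous_on_param, unfold split_beta)
       (intro comp_cont[OF u_cont] continuous_intros; auto)
  then show ?thesis by (simp add: mean_def split_beta)
qed

lemma char_deriv_cont: "continuous_on (UNIV \<times> {0..}) (\<lambda>(r, t). char_deriv \<kappa> x r t)"
proof -
  have "continuous_on (UNIV \<times> {0..}) (\<lambda>q. sphere_integral (\<lambda>n.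
    fst q * (G (x + fst q *\<^sub>R n, snd q) \<bullet> (- \<kappa> *\<^sub>R n, 1)) - \<kappa> * u (x + fst q *\<^sub>R n, snd q)))"
    by (rule sphere_integral_continuous_on_param, unfold split_beta)
       (intro comp_cont[OF G_cont] comp_cont[OF u_cont] continuous_intros; auto)
  then show ?thesis by (simp add: char_deriv_def split_beta)
qed

lemma mean_has_derivative:
  assumes "0 < b + s"
  shows "((\<lambda>s. s * mean x s (b + s)) has_real_derivative char_deriv (- 1) x s (b + s)) (at s)"
proof -
  have "((\<lambda>s. sphere_integral (\<lambda>n. s * u (x + s *\<^sub>R n, b + s))) has_real_derivative
    sphere_integral (\<lambda>n. s * (G (x + s *\<^sub>R n, b + s) \<bullet> (n, 1)) + u (x + s *\<^sub>R n, b + s))) (at s)"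
  proof (rule sphere_integral_has_derivative[of "{-b<..}"])
    fix s assume s: "s \<in> {-b<..}"
    show "continuous_on UNIV (\<lambda>n. s * u (x + s *\<^sub>R n, b + s))"
      using s by (intro comp_cont_sphere[OF u_cont] continuous_intros) auto
    fix n :: "real^3"
    have "((\<lambda>s. u ((x, b) + s *\<^sub>R (n, 1))) has_real_derivative G (x + s *\<^sub>R n, b + s) \<bullet> (n, 1)) (at s)"
      using s by (intro has_real_derivative_along_line) (use u_deriv_at[of "b + s" "x + s *\<^sub>R n"] in simp)
    then have "((\<lambda>s. u (x + s *\<^sub>R n, b + s)) has_real_derivative G (x + s *\<^sub>R n, b + s) \<bullet> (n, 1)) (at s)"
      by simp
    from DERIV_mult[OF DERIV_ident this]
    show "((\<lambda>s. s * u (x + s *\<^sub>R n, b + s)) has_real_derivative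
      s * (G (x + s *\<^sub>R n, b + s) \<bullet> (n, 1)) + u (x + s *\<^sub>R n, b + s)) (at s)"
      by (simp add: mult_ac add_ac)
  next
    show "continuous_on ({-b<..} \<times> UNIV)
      (\<lambda>(s, n). s * (G (x + s *\<^sub>R n, b + s) \<bullet> (n, 1)) + u (x + s *\<^sub>R n, b + s))"
      unfolding split_beta by (intro comp_cont[OF G_cont] comp_cont[OF u_cont] continuous_intros; auto)
  qed (use assms in auto)
  then show ?thesis by (simp add: mean_def char_deriv_def sphere_integral_cmult)
qed

text \<open>The integrand is the spherical Laplacian of u divided by r, in a form that avoids the
  division. It comes from the surface divergence identity for the spatial gradient of u at x + r n,
  whose derivative in n is r times the spatial Hessian.\<close>

lemma sphere_integral_radial_identity:
  assumes "0 < t"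
  shows "sphere_integral (\<lambda>n. r * ((\<Sum>i\<in>UNIV. N (x + r *\<^sub>R n, t) (axis i 1, 0) \<bullet> (axis i 1, 0))
      - N (x + r *\<^sub>R n, t) (n, 0) \<bullet> (n, 0)) - 2 * (G (x + r *\<^sub>R n, t) \<bullet> (n, 0))) = 0"
proof -
  let ?X = "\<lambda>n. fst (G (x + r *\<^sub>R n, t))" and ?X' = "\<lambda>n h. r *\<^sub>R fst (N (x + r *\<^sub>R n, t) (h, 0))"
  have "sphere_integral (\<lambda>n. (\<Sum>i\<in>UNIV. ?X' n (axis i 1) \<bullet> axis i 1) - ?X' n n \<bullet> n - 2 * (?X n \<bullet> n)) = 0"
  proof (rule sphere_integral_surface_divergence)
    fix n
    have lin: "linear (N (x + r *\<^sub>R n, t))" using assms by (intro N_linear) simp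
    have "((\<lambda>n. (x + r *\<^sub>R n, t)) has_derivative (\<lambda>h. (r *\<^sub>R h, 0))) (at n)"
      by (auto intro!: derivative_eq_intros)
    from has_derivative_fst[OF has_derivative_compose[OF this G_deriv_at[OF assms]]]
    have "(?X has_derivative (\<lambda>h. fst (N (x + r *\<^sub>R n, t) (r *\<^sub>R h, 0)))) (at n)" .
    moreover have "N (x + r *\<^sub>R n, t) (r *\<^sub>R h, 0) = r *\<^sub>R N (x + r *\<^sub>R n, t) (h, 0)" for h
      using linear_scale[OF lin, of r "(h, 0)"] by simp
    ultimately show "(?X has_derivative ?X' n) (at n)" by simp
  next
    fix h
    show "continuous_on UNIV (\<lambda>n. ?X' n h)"
      using assms by (intro continuous_intros comp_cont_sphere[OF N_cont]) auto
  qed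
  then show ?thesis
    by (simp add: inner_prod_def right_diff_distrib sum_distrib_left)
qed

lemma char_deriv_has_derivative:
  assumes \<kappa>: "\<kappa> * \<kappa> = 1" and "0 < t"
  shows "((\<lambda>s. char_deriv \<kappa> x (a + \<kappa> * s) s) has_real_derivative
    (a + \<kappa> * t) * source_mean x (a + \<kappa> * t) t) (at t)"
proof -
  define F' where "F' s n = (a + \<kappa> * s) * (N (x + (a + \<kappa> * s) *\<^sub>R n, s) (\<kappa> *\<^sub>R n, 1) \<bullet> (- \<kappa> *\<^sub>R n, 1))
    + \<kappa> * (G (x + (a + \<kappa> * s) *\<^sub>R n, s) \<bullet> (- \<kappa> *\<^sub>R n, 1))
    - \<kappa> * (G (x + (a + \<kappa> * s) *\<^sub>R n, s) \<bullet> (\<kappa> *\<^sub>R n, 1))" for s n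
  have "((\<lambda>s. sphere_integral (\<lambda>n. (a + \<kappa> * s) * (G (x + (a + \<kappa> * s) *\<^sub>R n, s) \<bullet> (- \<kappa> *\<^sub>R n, 1))
      - \<kappa> * u (x + (a + \<kappa> * s) *\<^sub>R n, s))) has_real_derivative sphere_integral (F' t)) (at t)"
  proof (rule sphere_integral_has_derivative[of "{0<..}"])
    fix s :: real assume s: "s \<in> {0<..}"
    show "continuous_on UNIV (\<lambda>n. (a + \<kappa> * s) * (G (x + (a + \<kappa> * s) *\<^sub>R n, s) \<bullet> (- \<kappa> *\<^sub>R n, 1))
      - \<kappa> * u (x + (a + \<kappa> * s) *\<^sub>R n, s))"
      using s by (intro comp_cont_sphere[OF u_cont] comp_cont_sphere[OF G_cont] continuous_intros) auto
    fix n :: "real^3"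
    have eq: "(x + a *\<^sub>R n, 0) + s *\<^sub>R (\<kappa> *\<^sub>R n, 1) = (x + (a + \<kappa> * s) *\<^sub>R n, s)" for s
      by (simp add: algebra_simps)
    have "((\<lambda>s. u ((x + a *\<^sub>R n, 0) + s *\<^sub>R (\<kappa> *\<^sub>R n, 1))) has_real_derivative
      G (x + (a + \<kappa> * s) *\<^sub>R n, s) \<bullet> (\<kappa> *\<^sub>R n, 1)) (at s)"
      using s by (intro has_real_derivative_along_line) (simp only: eq, auto intro: u_deriv_at)
    then have 1: "((\<lambda>s. u (x + (a + \<kappa> * s) *\<^sub>R n, s)) has_real_derivative
      G (x + (a + \<kappa> * s) *\<^sub>R n, s) \<bullet> (\<kappa> *\<^sub>R n, 1)) (at s)"
      unfolding eq .
    have "((\<lambda>s. G ((x + a *\<^sub>R n, 0) + s *\<^sub>R (\<kappa> *\<^sub>R n, 1)) \<bullet> (- \<kappa> *\<^sub>R n, 1)) has_real_derivative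
      N (x + (a + \<kappa> * s) *\<^sub>R n, s) (\<kappa> *\<^sub>R n, 1) \<bullet> (- \<kappa> *\<^sub>R n, 1)) (at s)"
      using s by (intro gradient_has_derivative_along_line) (simp only: eq, auto intro: G_deriv_at)
    then have 2: "((\<lambda>s. G (x + (a + \<kappa> * s) *\<^sub>R n, s) \<bullet> (- \<kappa> *\<^sub>R n, 1)) has_real_derivative
      N (x + (a + \<kappa> * s) *\<^sub>R n, s) (\<kappa> *\<^sub>R n, 1) \<bullet> (- \<kappa> *\<^sub>R n, 1)) (at s)"
      unfolding eq .
    have 3: "((\<lambda>s. a + \<kappa> * s) has_real_derivative \<kappa>) (at s)"
      by (auto intro!: derivative_eq_intros)
    from DERIV_diff[OF DERIV_mult[OF 3 2] DERIV_cmult[OF 1, of \<kappa>]]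
    show "((\<lambda>s. (a + \<kappa> * s) * (G (x + (a + \<kappa> * s) *\<^sub>R n, s) \<bullet> (- \<kappa> *\<^sub>R n, 1))
      - \<kappa> * u (x + (a + \<kappa> * s) *\<^sub>R n, s)) has_real_derivative F' s n) (at s)"
      by (rule DERIV_cong) (simp add: F'_def)
  next
    have N_cont': "continuous_on ({0<..} \<times> UNIV) (\<lambda>q. N (x + (a + \<kappa> * fst q) *\<^sub>R snd q, fst q) (\<kappa> *\<^sub>R snd q, 1))"
    proof (rule continuous_on_eq)
      show "continuous_on ({0<..} \<times> UNIV) (\<lambda>q.
        (\<Sum>i\<in>UNIV. (\<kappa> *\<^sub>R snd q)$i *\<^sub>R N (x + (a + \<kappa> * fst q) *\<^sub>R snd q, fst q) (axis i 1, 0))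
        + 1 *\<^sub>R N (x + (a + \<kappa> * fst q) *\<^sub>R snd q, fst q) (0, 1))"
        by (intro comp_cont[OF N_cont] continuous_intros; auto)
    qed (rule N_Pair[symmetric], auto)
    show "continuous_on ({0<..} \<times> UNIV) (\<lambda>(s, n). F' s n)"
      unfolding split_beta F'_def by (intro comp_cont[OF G_cont] N_cont' continuous_intros; auto)
  qed (use \<open>0 < t\<close> in auto)
  moreover have "sphere_integral (F' t) = (a + \<kappa> * t) * source_mean x (a + \<kappa> * t) t"
  proof -
    define r where "r = a + \<kappa> * t"
    let ?R = "\<lambda>n. r * ((\<Sum>i\<in>UNIV. N (x + r *\<^sub>R n, t) (axis i 1, 0) \<bullet> (axis i 1, 0))
      - N (x + r *\<^sub>R n, t) (n, 0) \<bullet> (n, 0)) - 2 * (G (x + r *\<^sub>R n, t) \<bullet> (n, 0))"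
    \<comment> \<open>The wave equation replaces u_tt by \<phi>(u) plus the Laplacian; beyond the
      source there remains exactly the integrand of
      \<open>sphere_integral_radial_identity\<close>.\<close>
    have F': "F' t n = r * \<phi> (u (x + r *\<^sub>R n, t)) + ?R n" for n
    proof -
      let ?z = "(x + r *\<^sub>R n, t)"
      have lin: "linear (N ?z)" using \<open>0 < t\<close> by (intro N_linear) simp
      have e: "(\<kappa> *\<^sub>R n, 1) = \<kappa> *\<^sub>R (n, 0) + (0, 1)" "(- \<kappa> *\<^sub>R n, 1) = (0, 1) - \<kappa> *\<^sub>R (n, 0)"
        by simp_all
      have "N ?z (\<kappa> *\<^sub>R n, 1) \<bullet> (- \<kappa> *\<^sub>R n, 1)
        = N ?z (0, 1) \<bullet> (0, 1) - \<kappa> * \<kappa> * (N ?z (n, 0) \<bullet> (n, 0))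
          + \<kappa> * (N ?z (n, 0) \<bullet> (0, 1) - N ?z (0, 1) \<bullet> (n, 0))"
        unfolding e linear_add[OF lin] linear_scale[OF lin]
        by (simp only: inner_add_left inner_diff_right inner_scaleR_left inner_scaleR_right)
           (simp add: algebra_simps)
      then have "N ?z (\<kappa> *\<^sub>R n, 1) \<bullet> (- \<kappa> *\<^sub>R n, 1) = N ?z (0, 1) \<bullet> (0, 1) - N ?z (n, 0) \<bullet> (n, 0)"
        using N_symmetric[OF \<open>0 < t\<close>, of "x + r *\<^sub>R n" "(n, 0)" "(0, 1)"] \<kappa> by simp
      moreover have "\<kappa> * (G ?z \<bullet> (- \<kappa> *\<^sub>R n, 1)) - \<kappa> * (G ?z \<bullet> (\<kappa> *\<^sub>R n, 1)) = - 2 * (\<kappa> * \<kappa>) * (G ?z \<bullet> (n, 0))"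
        unfolding e by (simp only: inner_add_right inner_diff_right inner_scaleR_right)
           (simp add: algebra_simps)
      ultimately have "F' t n = r * (N ?z (0, 1) \<bullet> (0, 1) - N ?z (n, 0) \<bullet> (n, 0)) - 2 * (G ?z \<bullet> (n, 0))"
        using \<kappa> by (simp add: F'_def flip: r_def)
      also have "\<dots> = r * \<phi> (u ?z) + ?R n"
        unfolding wave_N[OF \<open>0 < t\<close>, symmetric] by (simp add: algebra_simps)
      finally show ?thesis .
    qed
    have N_n: "continuous_on UNIV (\<lambda>n. N (x + r *\<^sub>R n, t) (n, 0))"
    proof (rule continuous_on_eq)
      show "continuous_on UNIV (\<lambda>n. (\<Sum>i\<in>UNIV. n$i *\<^sub>R N (x + r *\<^sub>R n, t) (axis i 1, 0))
        + 0 *\<^sub>R N (x + r *\<^sub>R n, t) (0, 1))"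
        using \<open>0 < t\<close> by (intro comp_cont_sphere[OF N_cont] continuous_intros; auto)
    qed (rule N_Pair[symmetric], use \<open>0 < t\<close> in auto)
    have "sphere_integral (F' t) = sphere_integral (\<lambda>n. r * \<phi> (u (x + r *\<^sub>R n, t))) + sphere_integral ?R"
      unfolding F' using \<open>0 < t\<close>
      by (intro sphere_integral_add)
         (intro continuous_intros comp_cont_sphere[OF \<phi>_u_cont] comp_cont_sphere[OF N_cont]
           comp_cont_sphere[OF G_cont] N_n; simp)+
    then show ?thesis
      unfolding sphere_integral_radial_identity[OF \<open>0 < t\<close>]
      by (simp add: source_mean_def sphere_integral_cmult flip: r_def)
  qed
  ultimately show ?thesis by (simp add: char_deriv_def)
qed

end

section \<open>Vanishing of global solutions\<close>

lemma continuous_on_half_plane_path: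
  fixes F :: "real \<Rightarrow> real \<Rightarrow> real"
  assumes "continuous_on (UNIV \<times> {0..}) (\<lambda>(r, t). F r t)"
    and "continuous_on S f" "continuous_on S g" "\<And>s. s \<in> S \<Longrightarrow> 0 \<le> g s"
  shows "continuous_on S (\<lambda>s. F (f s) (g s))"
proof -
  have "continuous_on S (\<lambda>s. (\<lambda>(r, t). F r t) (f s, g s))"
    by (rule continuous_on_compose2[OF assms(1)]) (use assms in \<open>auto intro!: continuous_intros\<close>)
  then show ?thesis by simp
qed

locale superlinear_wave = wave_solution +
  fixes A p R :: real
  assumes A: "0 < A" and p: "1 < p" "p < 1 + sqrt 2" and R: "0 < R"
    and \<phi>_lower: "\<And>s. A * \<bar>s\<bar> powr p \<le> \<phi> s"
    and data_support: "\<And>x. R < norm x \<Longrightarrow> u (x, 0) = 0 \<and> G (x, 0) = 0"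
begin

lemma \<phi>_nonneg: "0 \<le> \<phi> s"
  using \<phi>_lower[of s] A by (smt (verit) mult_nonneg_nonneg powr_ge_zero)

lemma source_mean_nonneg: "0 \<le> t \<Longrightarrow> 0 \<le> source_mean x r t"
  unfolding source_mean_def
  by (intro sphere_integral_nonneg comp_cont_sphere[OF \<phi>_u_cont] \<phi>_nonneg) auto

lemma source_mean_lower:
  assumes "0 \<le> t"
  shows "A * (4 * pi) * (\<bar>mean x r t\<bar> / (4 * pi)) powr p \<le> source_mean x r t"
proof -
  have u: "continuous_on UNIV (\<lambda>n. u (x + r *\<^sub>R n, t))" by (rule comp_cont_sphere[OF u_cont assms])
  have "A * (4 * pi * (\<bar>mean x r t\<bar> / (4 * pi)) powr p) \<le> A * sphere_integral (\<lambda>n. \<bar>u (x + r *\<^sub>R n, t)\<bar> powr p)"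
    unfolding mean_def using A p u by (intro mult_left_mono sphere_integral_Jensen) auto
  also have "\<dots> = sphere_integral (\<lambda>n. A * \<bar>u (x + r *\<^sub>R n, t)\<bar> powr p)"
    by (simp add: sphere_integral_cmult)
  also have "\<dots> \<le> source_mean x r t"
    unfolding source_mean_def
  proof (rule sphere_integral_mono)
    show "continuous_on UNIV (\<lambda>n. A * \<bar>u (x + r *\<^sub>R n, t)\<bar> powr p)"
      using p by (intro continuous_intros continuous_on_powr'[OF _ continuous_on_const] u) auto
  qed (use assms \<phi>_lower in \<open>auto intro: comp_cont_sphere[OF \<phi>_u_cont]\<close>)
  finally show ?thesis by (simp add: mult.assoc)
qed

section \<open>Blow-up for the means about the origin\<close>

abbreviation W :: "real \<Rightarrow> real \<Rightarrow> real" where "W \<equiv> char_deriv (- 1) 0"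

lemma W_has_derivative:
  "0 < t \<Longrightarrow> ((\<lambda>s. W (\<xi> - s) s) has_real_derivative (\<xi> - t) * source_mean 0 (\<xi> - t) t) (at t)"
  using char_deriv_has_derivative[of "- 1" t 0 \<xi>] by simp

lemma W_cont: "continuous_on {0..} (\<lambda>s. W (\<xi> - s) s)"
  by (rule continuous_on_half_plane_path[OF char_deriv_cont]) (auto intro!: continuous_intros)

lemma W_initial:
  assumes "R < \<xi>"
  shows "W \<xi> 0 = 0"
proof -
  have "W \<xi> 0 = sphere_integral (\<lambda>n. 0)"
    unfolding char_deriv_def
  proof (rule sphere_integral_cong)
    fix n :: "real^3" assume "norm n = 1"
    then have "R < norm (0 + \<xi> *\<^sub>R n)" using assms R by simp
    then show "\<xi> * (G (0 + \<xi> *\<^sub>R n, 0) \<bullet> (- (- 1) *\<^sub>R n, 1)) - - 1 * u (0 + \<xi> *\<^sub>R n, 0) = 0"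
      using data_support by simp
  qed
  then show ?thesis by simp
qed

text \<open>The derivative along the incoming line is r times a nonnegative source, and r = \<xi> -
  t stays nonnegative up to t = \<xi>, where the line reaches the axis.\<close>

lemma W_mono:
  assumes "R < \<xi>" "0 \<le> s" "s \<le> t" "t \<le> \<xi>"
  shows "W (\<xi> - s) s \<le> W (\<xi> - t) t"
proof -
  have "0 * (t - s) \<le> W (\<xi> - t) t - W (\<xi> - s) s"
  proof (rule increment_ge)
    show "continuous_on {s..t} (\<lambda>s. W (\<xi> - s) s)"
      using assms by (intro continuous_on_subset[OF W_cont]) auto
  next
    fix y assume "s < y" "y < t"
    then show "\<exists>d\<ge>0. ((\<lambda>s. W (\<xi> - s) s) has_real_derivative d) (at y)"
      using assms W_has_derivative[of y \<xi>] source_mean_nonneg[of y 0 "\<xi> - y"]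
      by (intro exI[of _ "(\<xi> - y) * source_mean 0 (\<xi> - y) y"]) auto
  qed (use assms in auto)
  then show ?thesis by simp
qed

lemma W_nonneg: "R < \<xi> \<Longrightarrow> 0 \<le> t \<Longrightarrow> t \<le> \<xi> \<Longrightarrow> 0 \<le> W (\<xi> - t) t"
  using W_mono[of \<xi> 0 t] W_initial[of \<xi>] by simp

text \<open>In the null coordinates \<open>\<alpha> = t + r\<close> and \<open>\<beta> = t - r\<close>; strong Huygens makes the data invisible
  for \<open>\<beta> > R\<close>.\<close>

sublocale characteristic_pair
  "\<lambda>\<alpha> \<beta>. (\<alpha> - \<beta>) / 2 * mean 0 ((\<alpha> - \<beta>) / 2) ((\<alpha> + \<beta>) / 2)"
  "\<lambda>\<alpha> \<beta>. W ((\<alpha> - \<beta>) / 2) ((\<alpha> + \<beta>) / 2) / 2"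
  p "A * (4 * pi) powr (1 - p) * (1 / 2) powr (1 - p) / 4" R
proof unfold_locales
  show "0 < A * (4 * pi) powr (1 - p) * (1 / 2) powr (1 - p) / 4"
    using A by simp
next
  fix \<beta> assume \<beta>: "R < \<beta>"
  show "(\<beta> - \<beta>) / 2 * mean 0 ((\<beta> - \<beta>) / 2) ((\<beta> + \<beta>) / 2) = 0" by simp
  have "continuous_on {\<beta>..} (\<lambda>\<alpha>. mean 0 ((\<alpha> - \<beta>) / 2) ((\<alpha> + \<beta>) / 2))"
    by (rule continuous_on_half_plane_path[OF mean_cont]) (use \<beta> R in \<open>auto intro!: continuous_intros\<close>)
  then show "continuous_on {\<beta>..} (\<lambda>\<alpha>. (\<alpha> - \<beta>) / 2 * mean 0 ((\<alpha> - \<beta>) / 2) ((\<alpha> + \<beta>) / 2))"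
    by (intro continuous_intros) auto
next
  fix \<alpha> \<beta> assume \<alpha>\<beta>: "R < \<beta>" "\<beta> < \<alpha>"
  have "continuous_on {R<..<\<alpha>} (\<lambda>\<beta>. mean 0 ((\<alpha> - \<beta>) / 2) ((\<alpha> + \<beta>) / 2))"
    by (rule continuous_on_half_plane_path[OF mean_cont]) (use \<alpha>\<beta> R in \<open>auto intro!: continuous_intros\<close>)
  then have "continuous_on {R<..<\<alpha>} (\<lambda>\<beta>. (\<alpha> - \<beta>) / 2 * mean 0 ((\<alpha> - \<beta>) / 2) ((\<alpha> + \<beta>) / 2))"
    by (intro continuous_intros) auto
  then show "isCont (\<lambda>\<beta>. (\<alpha> - \<beta>) / 2 * mean 0 ((\<alpha> - \<beta>) / 2) ((\<alpha> + \<beta>) / 2)) \<beta>"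
    using \<alpha>\<beta> by (simp add: continuous_on_eq_continuous_at)
  have sum: "\<beta> + (x - \<beta>) / 2 = (x + \<beta>) / 2" for x by (simp add: field_simps)
  have half: "((\<lambda>x. (x - \<beta>) / 2) has_real_derivative 1 / 2) (at \<alpha>)"
    by (auto intro!: derivative_eq_intros)
  have "0 < \<beta> + (\<alpha> - \<beta>) / 2" using \<alpha>\<beta> R by (simp add: sum)
  from DERIV_chain2[OF mean_has_derivative[OF this] half, of 0]
  show "((\<lambda>\<alpha>. (\<alpha> - \<beta>) / 2 * mean 0 ((\<alpha> - \<beta>) / 2) ((\<alpha> + \<beta>) / 2)) has_real_derivative
      W ((\<alpha> - \<beta>) / 2) ((\<alpha> + \<beta>) / 2) / 2) (at \<alpha>)"
    unfolding sum by simp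
  have diff: "\<alpha> - (\<alpha> + y) / 2 = (\<alpha> - y) / 2" for y by (simp add: field_simps)
  show "0 \<le> W ((\<alpha> - \<beta>) / 2) ((\<alpha> + \<beta>) / 2) / 2"
    using W_nonneg[of \<alpha> "(\<alpha> + \<beta>) / 2"] \<alpha>\<beta> R by (simp add: diff)
  have half': "((\<lambda>y. (\<alpha> + y) / 2) has_real_derivative 1 / 2) (at \<beta>)"
    by (auto intro!: derivative_eq_intros)
  define r t where "r = (\<alpha> - \<beta>) / 2" and "t = (\<alpha> + \<beta>) / 2"
  have rt: "0 < r" "0 < t" "\<alpha> - \<beta> = 2 * r" using \<alpha>\<beta> R by (auto simp: r_def t_def)
  have "0 < (\<alpha> + \<beta>) / 2" using \<alpha>\<beta> R by simp
  from DERIV_cdivide[OF DERIV_chain2[OF W_has_derivative[OF this, of \<alpha>] half'], of 2]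
  have "((\<lambda>\<beta>. W ((\<alpha> - \<beta>) / 2) ((\<alpha> + \<beta>) / 2) / 2) has_real_derivative r * source_mean 0 r t / 4) (at \<beta>)"
    unfolding diff by (simp add: r_def t_def)
  \<comment> \<open>In the constant, 1/4 comes from v_tt - v_rr being four times the mixed
    \<alpha>\<beta>-derivative, the power of 4 pi from Jensen's inequality with an unnormalised
    integral, and the power of 1/2 from r = (\<alpha> - \<beta>) / 2.\<close>
  moreover have "A * (4 * pi) powr (1 - p) * (1 / 2) powr (1 - p) / 4 * (\<alpha> - \<beta>) powr (1 - p)
      * \<bar>r * mean 0 r t\<bar> powr p \<le> r * source_mean 0 r t / 4"
  proof -
    let ?m = "\<bar>mean 0 r t\<bar>"
    have "(4 * pi) powr (1 - p) = 4 * pi * (1 / (4 * pi)) powr p"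
      by (simp add: powr_diff powr_divide)
    then have "(4 * pi) powr (1 - p) * ?m powr p = 4 * pi * (?m / (4 * pi)) powr p"
      by (simp add: powr_divide)
    moreover have "(1 / 2) powr (1 - p) * (2 * r) powr (1 - p) * r powr p = r"
      using rt by (simp flip: powr_mult powr_add)
    ultimately have "((4 * pi) powr (1 - p) * ?m powr p) * ((1 / 2) powr (1 - p) * (2 * r) powr (1 - p) * r powr p)
      = 4 * pi * (?m / (4 * pi)) powr p * r"
      by simp
    then have "A * (4 * pi) powr (1 - p) * (1 / 2) powr (1 - p) / 4 * (2 * r) powr (1 - p) * \<bar>r * mean 0 r t\<bar> powr p
      = r * (A * (4 * pi) * (?m / (4 * pi)) powr p) / 4"
      using rt by (simp add: abs_mult powr_mult mult_ac)
    also have "\<dots> \<le> r * source_mean 0 r t / 4"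
      using rt source_mean_lower[of t 0 r] by (intro divide_right_mono mult_left_mono) auto
    finally show ?thesis unfolding rt(3) .
  qed
  ultimately show "\<exists>d\<ge>A * (4 * pi) powr (1 - p) * (1 / 2) powr (1 - p) / 4 * (\<alpha> - \<beta>) powr (1 - p)
      * \<bar>(\<alpha> - \<beta>) / 2 * mean 0 ((\<alpha> - \<beta>) / 2) ((\<alpha> + \<beta>) / 2)\<bar> powr p.
      ((\<lambda>\<beta>. W ((\<alpha> - \<beta>) / 2) ((\<alpha> + \<beta>) / 2) / 2) has_real_derivative d) (at \<beta>)"
    unfolding r_def t_def by blast
qed (use p R in auto)

text \<open>Extends the vanishing from t - r > R to t + r > R. On the incoming line \<open>W\<close>
  starts at 0, is nondecreasing, and is 0 again at a late time T by \<open>Q_eq_0\<close>; so it is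
  constant up to T and its derivative r times the source mean is zero.\<close>

lemma source_mean_eq_0:
  assumes "R < \<xi>" "0 < t" "t < \<xi>"
  shows "source_mean 0 (\<xi> - t) t = 0"
proof -
  \<comment> \<open>Any \<beta> with R < \<beta> < \<xi> and t \<le> \<beta> serves. T is the time
    at which the incoming line meets t - r = \<beta>, which is later than the given time t.\<close>
  define \<beta> where "\<beta> = max ((\<xi> + R) / 2) t"
  define T where "T = (\<xi> + \<beta>) / 2"
  have \<beta>: "R < \<beta>" "\<beta> < \<xi>" "t < T" "T < \<xi>" using assms by (auto simp: \<beta>_def T_def less_max_iff_disj)
  have "W (\<xi> - T) T = 0"
  proof -
    have "\<xi> - T = (\<xi> - \<beta>) / 2" by (simp add: T_def field_simps)
    then have "W (\<xi> - T) T = W ((\<xi> - \<beta>) / 2) ((\<xi> + \<beta>) / 2)" by (simp only: T_def)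
    then show ?thesis using Q_eq_0[OF \<beta>(1,2)] by simp
  qed
  then have zero: "W (\<xi> - s) s = 0" if "0 \<le> s" "s \<le> T" for s
    using W_mono[of \<xi> s T] W_nonneg[of \<xi> s] that assms \<beta> by simp
  have "eventually (\<lambda>s. s \<in> {0<..<T}) (nhds t)"
    using assms \<beta> by (intro eventually_nhds_in_open) auto
  then have "eventually (\<lambda>s. W (\<xi> - s) s = 0) (nhds t)"
    by eventually_elim (use zero in auto)
  then have "((\<lambda>s. W (\<xi> - s) s) has_real_derivative 0) (at t)"
    using DERIV_cong_ev[of t t "\<lambda>s. W (\<xi> - s) s" "\<lambda>_. 0" 0 0] by simp
  from DERIV_unique[OF W_has_derivative[OF assms(2)] this]
  show ?thesis using assms by simp
qed

lemma u_eq_0_outside: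
  assumes "0 < t" "R < norm x + t"
  shows "u (x, t) = 0"
proof -
  have off_center: "u (x, t) = 0" if "x \<noteq> 0" "R < norm x + t" for x
  proof -
    define r n where "r = norm x" and "n = x /\<^sub>R r"
    have r: "0 < r" and n: "norm n = 1" "x = r *\<^sub>R n" using that by (auto simp: r_def n_def)
    have "source_mean 0 r t = 0"
      using source_mean_eq_0[of "r + t" t] that r assms by (simp add: r_def)
    then have "\<phi> (u (0 + r *\<^sub>R n, t)) = 0"
      unfolding source_mean_def using assms n \<phi>_nonneg
      by (intro sphere_integral_eq_0[of "\<lambda>n. \<phi> (u (0 + r *\<^sub>R n, t))"] comp_cont_sphere[OF \<phi>_u_cont]) auto
    then have "A * \<bar>u (x, t)\<bar> powr p \<le> 0" using \<phi>_lower[of "u (x, t)"] n by simp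
    then show ?thesis using A by (simp add: mult_le_0_iff)
  qed
  show ?thesis
  proof (cases "x = 0")
    case True
    \<comment> \<open>The sphere argument needs r > 0; the centre is reached as a limit of points s
      times a fixed unit vector, which also satisfy the condition because R < t here.\<close>
    have "isCont (\<lambda>s. u (s *\<^sub>R axis 1 1, t)) 0"
      using comp_cont[OF u_cont, of "UNIV :: real set" "\<lambda>s. s" "\<lambda>_. t" "\<lambda>_. axis 1 1" 0] assms
      by (simp add: continuous_on_eq_continuous_at)
    then have "((\<lambda>s. u (s *\<^sub>R axis 1 1, t)) \<longlongrightarrow> u (0, t)) (at 0)" by (simp add: isCont_def)
    moreover have "eventually (\<lambda>s :: real. s \<noteq> 0) (at 0)" by (simp add: eventually_at_filter)
    then have "eventually (\<lambda>s. u (s *\<^sub>R axis 1 1, t) = 0) (at 0)"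
    proof eventually_elim
      case (elim s)
      then have "0 < \<bar>s\<bar>" by simp
      then show ?case using assms True elim by (intro off_center) (auto simp: axis_eq_0_iff)
    qed
    then have "((\<lambda>s. u (s *\<^sub>R axis 1 1, t)) \<longlongrightarrow> 0) (at 0)" by (rule tendsto_eventually)
    ultimately show ?thesis using True LIM_unique by blast
  qed (use off_center assms in auto)
qed

section \<open>Uniqueness backwards in time\<close>

lemma u_bounded:
  obtains B where "\<And>x t. 0 < t \<Longrightarrow> \<bar>u (x, t)\<bar> \<le> B"
proof -
  have "compact (u ` (cball 0 R \<times> {0..R}))"
    by (intro compact_continuous_image compact_Times continuous_on_subset[OF u_cont]) auto
  then obtain B where B: "\<And>y. y \<in> u ` (cball 0 R \<times> {0..R}) \<Longrightarrow> \<bar>y\<bar> \<le> B"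
    using compact_imp_bounded bounded_iff by (metis real_norm_def)
  have "\<bar>u (x, t)\<bar> \<le> max B 0" if "0 < t" for x t
  proof (cases "R < norm x + t")
    case True
    then show ?thesis using u_eq_0_outside that by simp
  next
    case False
    have "norm x \<le> R" "t \<le> R" using False that norm_ge_zero[of x] by linarith+
    then have "(x, t) \<in> cball 0 R \<times> {0..R}" using that by simp
    then show ?thesis using B by fastforce
  qed
  then show ?thesis using that by blast
qed

lemma G_eq_0:
  assumes zero: "\<And>x t. T \<le> t \<Longrightarrow> 0 < t \<Longrightarrow> u (x, t) = 0" and "T < t" "0 < t"
  shows "G (x, t) = 0"
proof -
  have "eventually (\<lambda>z. z \<in> UNIV \<times> {max 0 T<..}) (nhds (x, t))"
    using assms by (intro eventually_nhds_in_open open_Times) auto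
  then have "eventually (\<lambda>z. 0 = u z) (nhds (x, t))"
    by eventually_elim (use zero in auto)
  moreover have "((\<lambda>z. 0) has_derivative (\<lambda>h. 0)) (at (x, t))" by simp
  ultimately have "(u has_derivative (\<lambda>h. 0)) (at (x, t))"
    using has_derivative_transform_eventually[of "\<lambda>z. 0" "\<lambda>h. 0" "(x, t)" UNIV u]
    by (simp add: eventually_nhds_conv_at)
  then have "(\<lambda>h. G (x, t) \<bullet> h) = (\<lambda>h. 0)"
    using u_deriv_at[OF assms(3), of x] has_derivative_unique by blast
  then have "G (x, t) \<bullet> G (x, t) = 0" by (rule fun_cong)
  then show ?thesis by simp
qed

text \<open>Kirchhoff's formula on the forward light cone with vertex (x, t): the cone soon enters
  the region where u and its gradient vanish, so u(x, t) is given by the source on the short cone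
  alone, and the source is at most C times the bound b.\<close>

lemma backward_halving:
  assumes zero: "\<And>x t. T \<le> t \<Longrightarrow> 0 < t \<Longrightarrow> u (x, t) = 0"
    and C: "1 \<le> C" "\<And>x t. 0 < t \<Longrightarrow> \<phi> (u (x, t)) \<le> C * \<bar>u (x, t)\<bar>"
    and b: "\<And>x t. T - 1 / (4 * C) \<le> t \<Longrightarrow> 0 < t \<Longrightarrow> \<bar>u (x, t)\<bar> \<le> b"
    and t: "T - 1 / (4 * C) \<le> t" "0 < t"
  shows "\<bar>u (x, t)\<bar> \<le> b / 2"
proof -
  \<comment> \<open>Twice the time step, so that the cone ends strictly after T, where
    \<open>G_eq_0\<close> applies; still \<delta>^2 C = 1 / (4 C) is below 1/2 because C \<ge>
    1.\<close>
  define \<delta> where "\<delta> = 1 / (2 * C)"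
  define f where "f s = char_deriv 1 x (- t + s) s" for s
  have \<delta>: "0 < \<delta>" using C by (simp add: \<delta>_def)
  have "1 / (4 * C) < \<delta>" using C by (simp add: \<delta>_def field_simps)
  then have T: "T < t + \<delta>" using t by simp
  have f_deriv: "(f has_real_derivative (- t + s) * source_mean x (- t + s) s) (at s)" if "0 < s" for s
    using char_deriv_has_derivative[of 1 s x "- t"] that by (simp add: f_def[abs_def])
  have "t < t + \<delta>" using \<delta> by simp
  then obtain s where s: "t < s" "s < t + \<delta>"
    "f (t + \<delta>) - f t = (t + \<delta> - t) * ((- t + s) * source_mean x (- t + s) s)"
    using MVT2[of t "t + \<delta>" f "\<lambda>s. (- t + s) * source_mean x (- t + s) s"] f_deriv t by auto
  \<comment> \<open>At the vertex r = 0, so the gradient term drops out and only -u(x, t) is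
    integrated.\<close>
  have "f t = sphere_integral (\<lambda>n. - u (x, t))" by (simp add: f_def char_deriv_def)
  then have f_t: "f t = - (4 * pi * u (x, t))" by simp
  have "f (t + \<delta>) = sphere_integral (\<lambda>n. 0)"
    unfolding f_def char_deriv_def
  proof (rule sphere_integral_cong)
    fix n
    show "(- t + (t + \<delta>)) * (G (x + (- t + (t + \<delta>)) *\<^sub>R n, t + \<delta>) \<bullet> (- 1 *\<^sub>R n, 1))
      - 1 * u (x + (- t + (t + \<delta>)) *\<^sub>R n, t + \<delta>) = 0"
      using G_eq_0[OF zero T] zero T t \<delta> by simp
  qed
  then have f_end: "f (t + \<delta>) = 0" by simp
  have "\<bar>source_mean x (- t + s) s\<bar> \<le> 4 * pi * (C * b)"
    unfolding source_mean_def
  proof (rule sphere_integral_abs_le)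
    show "continuous_on UNIV (\<lambda>n. \<phi> (u (x + (- t + s) *\<^sub>R n, s)))"
      using s t by (intro comp_cont_sphere[OF \<phi>_u_cont]) simp
    fix n
    have "\<phi> (u (x + (- t + s) *\<^sub>R n, s)) \<le> C * \<bar>u (x + (- t + s) *\<^sub>R n, s)\<bar>"
      using C(2) s t by simp
    also have "\<dots> \<le> C * b" using C s t by (intro mult_left_mono b) auto
    finally show "\<bar>\<phi> (u (x + (- t + s) *\<^sub>R n, s))\<bar> \<le> C * b" using \<phi>_nonneg by simp
  qed
  moreover have "0 \<le> b" using b[OF t, of x] by simp
  ultimately have "\<bar>f (t + \<delta>) - f t\<bar> \<le> \<delta> * (\<delta> * (4 * pi * (C * b)))"
    unfolding s(3) abs_mult using s \<delta> C by (intro mult_mono) auto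
  then have "4 * pi * \<bar>u (x, t)\<bar> \<le> 4 * pi * (\<delta> * \<delta> * C * b)"
    using f_t f_end by (simp add: abs_mult mult_ac)
  then have "\<bar>u (x, t)\<bar> \<le> \<delta> * \<delta> * C * b" by simp
  also have "\<delta> * \<delta> * C = 1 / (4 * C)" using C by (simp add: \<delta>_def field_simps)
  also have "1 / (4 * C) * b \<le> 1 / 2 * b" using C \<open>0 \<le> b\<close> by (intro mult_right_mono) (auto simp: field_simps)
  finally show ?thesis by simp
qed

text \<open>The global bound on u starts the halving, and repeating it on the same time interval
  drives the bound to 0.\<close>

lemma backward_step:
  assumes zero: "\<And>x t. T \<le> t \<Longrightarrow> 0 < t \<Longrightarrow> u (x, t) = 0"
    and C: "1 \<le> C" "\<And>x t. 0 < t \<Longrightarrow> \<phi> (u (x, t)) \<le> C * \<bar>u (x, t)\<bar>"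
    and t: "T - 1 / (4 * C) \<le> t" "0 < t"
  shows "u (x, t) = 0"
proof -
  obtain B where B: "\<And>x t. 0 < t \<Longrightarrow> \<bar>u (x, t)\<bar> \<le> B" using u_bounded by blast
  have bound: "\<bar>u (x, t)\<bar> \<le> B / 2 ^ n" if "T - 1 / (4 * C) \<le> t" "0 < t" for n x t
    using that
  proof (induction n arbitrary: x t)
    case 0
    then show ?case using B by simp
  next
    case (Suc n)
    from backward_halving[OF zero C Suc.IH Suc.prems, of x] show ?case by simp
  qed
  have "(\<lambda>n. B / 2 ^ n) \<longlonglongrightarrow> 0" by real_asymp
  then have "\<bar>u (x, t)\<bar> \<le> 0" using bound[OF t] by (intro LIMSEQ_le_const) auto
  then show ?thesis by simp
qed

text \<open>The step length 1 / (4 C) does not depend on T, so finitely many steps lead from the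
  late time R + 1 down to any t > 0.\<close>

lemma u_eq_0:
  assumes C: "1 \<le> C" "\<And>x t. 0 < t \<Longrightarrow> \<phi> (u (x, t)) \<le> C * \<bar>u (x, t)\<bar>" and "0 < t"
  shows "u (x, t) = 0"
proof -
  have "u (x, t) = 0" if "R + 1 - of_nat n * (1 / (4 * C)) \<le> t" "0 < t" for n x t
    using that
  proof (induction n arbitrary: x t)
    case 0
    then have "R < norm x + t" using norm_ge_zero[of x] by linarith
    then show ?case using u_eq_0_outside 0 by simp
  next
    case (Suc n)
    show ?case
    proof (rule backward_step[OF Suc.IH C])
      show "R + 1 - of_nat n * (1 / (4 * C)) - 1 / (4 * C) \<le> t"
        using Suc.prems(1) by (simp add: algebra_simps add_divide_distrib)
    qed (use Suc.prems in auto)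
  qed
  moreover obtain n where "R + 1 < of_nat n * (1 / (4 * C))"
    using ex_less_of_nat_mult[of "1 / (4 * C)" "R + 1"] C by auto
  ultimately show ?thesis using assms(3) by (metis diff_gt_0_iff_gt less_eq_real_def less_iff_diff_less_0 order_less_trans)
qed

end

lemma locally_linear_bound:
  fixes \<phi> :: "real \<Rightarrow> real"
  assumes cont: "continuous_on UNIV \<phi>" and "\<phi> 0 = 0"
    and lim: "Limsup (at 0) (\<lambda>s. ereal (\<phi> s / \<bar>s\<bar>)) < \<infinity>"
  obtains C where "1 \<le> C" "\<And>s. \<bar>s\<bar> \<le> B \<Longrightarrow> \<phi> s \<le> C * \<bar>s\<bar>"
proof -
  obtain c :: real where "Limsup (at 0) (\<lambda>s. ereal (\<phi> s / \<bar>s\<bar>)) < ereal c"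
    using lim ereal_dense2 by blast
  then have "eventually (\<lambda>s. ereal (\<phi> s / \<bar>s\<bar>) < ereal c) (at 0)"
    by (rule Limsup_lessD)
  then obtain d where d: "0 < d" "\<And>s. s \<noteq> 0 \<Longrightarrow> \<bar>s\<bar> < d \<Longrightarrow> \<phi> s / \<bar>s\<bar> < c"
    unfolding eventually_at by (auto simp: dist_real_def)
  have "compact (\<phi> ` {-B..B})"
    by (intro compact_continuous_image continuous_on_subset[OF cont]) auto
  then obtain M where M: "\<And>y. y \<in> \<phi> ` {-B..B} \<Longrightarrow> \<bar>y\<bar> \<le> M"
    using compact_imp_bounded bounded_iff by (metis real_norm_def)
  \<comment> \<open>The summand |c| handles small s through the limsup. For d \<le> |s| \<le> B
    compactness bounds \<phi> by |M|, and |s| / d \<ge> 1 makes |M| / d sufficient.\<close>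
  define C where "C = 1 + \<bar>c\<bar> + \<bar>M\<bar> / d"
  have Md: "0 \<le> \<bar>M\<bar> / d" using d by simp
  show ?thesis
  proof (rule that[of C])
    show "1 \<le> C" using Md by (simp add: C_def)
    fix s assume s: "\<bar>s\<bar> \<le> B"
    consider "s = 0" | "s \<noteq> 0" "\<bar>s\<bar> < d" | "d \<le> \<bar>s\<bar>" by linarith
    then show "\<phi> s \<le> C * \<bar>s\<bar>"
    proof cases
      case 2
      then have "\<phi> s \<le> c * \<bar>s\<bar>" using d(2)[of s] by (simp add: divide_simps split: if_splits)
      also have "\<dots> \<le> C * \<bar>s\<bar>" using Md by (intro mult_right_mono) (auto simp: C_def)
      finally show ?thesis .
    next
      case 3
      have "s \<in> {-B..B}" using s by auto
      then have "\<phi> s \<le> \<bar>M\<bar>" using M[of "\<phi> s"] by fastforce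
      also have "\<dots> = \<bar>M\<bar> / d * d" using d by simp
      also have "\<dots> \<le> C * \<bar>s\<bar>" using 3 d Md by (intro mult_mono) (auto simp: C_def)
      finally show ?thesis .
    qed (simp add: assms)
  qed
qed

lemma compactly_supported_bound:
  assumes "compactly_supported f"
  obtains R where "0 < R" "\<And>x. R < norm x \<Longrightarrow> f x = 0"
proof -
  have "bounded {x. f x \<noteq> 0}"
    using assms unfolding compactly_supported_def
    by (meson bounded_subset closure_subset compact_imp_bounded)
  then obtain R where "0 < R" "\<And>x. x \<in> {x. f x \<noteq> 0} \<Longrightarrow> norm x \<le> R"
    unfolding bounded_pos by blast
  then show ?thesis using that[of R] by fastforce
qed

theorem theorem1p1:
  fixes \<phi> :: "real \<Rightarrow> real"
    and f g :: "real^3 \<Rightarrow> real"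
    and u :: "(real^3) \<times> real \<Rightarrow> real"
  assumes "continuous_on UNIV \<phi>"
    and "\<phi> 0 = 0"
    and "Limsup (at 0) (\<lambda>s. ereal (\<phi> s / \<bar>s\<bar>)) < \<infinity>"
    and "\<exists>A p. 0 < A \<and> 1 < p \<and> p < 1 + sqrt 2 \<and> (\<forall>s. A * \<bar>s\<bar> powr p \<le> \<phi> s)"
    and "C_class_on 3 UNIV f" and "compactly_supported f"
    and "C_class_on 2 UNIV g" and "compactly_supported g"
    and "C_class_on 2 (UNIV \<times> {0..}) u"
    and "\<And>x t. 0 < t \<Longrightarrow> dAlembertian u (x, t) = \<phi> (u (x, t))"
    and "\<And>x. u (x, 0) = f x"
    and "\<And>x. ((\<lambda>t. u (x, t)) has_real_derivative g x) (at 0 within {0..})"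
  shows "\<forall>x. \<forall>t\<ge>0. u (x, t) = 0"
proof -
  obtain A p where Ap: "0 < A" "1 < p" "p < 1 + sqrt 2" "\<And>s. A * \<bar>s\<bar> powr p \<le> \<phi> s"
    using assms(4) by blast
  obtain G N where GN: "\<And>z. z \<in> upper_half \<Longrightarrow> (u has_derivative (\<lambda>h. G z \<bullet> h)) (at z within upper_half)"
    "\<And>z. z \<in> upper_half \<Longrightarrow> (G has_derivative N z) (at z within upper_half)"
    "\<And>h. continuous_on upper_half (\<lambda>z. N z h)"
    using C_class_on_2_gradient[OF assms(9)] by blast
  obtain Rf where Rf: "0 < Rf" "\<And>x. Rf < norm x \<Longrightarrow> f x = 0"
    using compactly_supported_bound[OF assms(6)] by blast
  obtain Rg where Rg: "0 < Rg" "\<And>x. Rg < norm x \<Longrightarrow> g x = 0"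
    using compactly_supported_bound[OF assms(8)] by blast
  \<comment> \<open>The spatial part vanishes because u(., 0) = f is zero near x; the time part
    equals g(x) by uniqueness of the one-sided derivative at 0.\<close>
  have G0: "G (x, 0) = 0" if x: "max Rf Rg < norm x" for x
  proof -
    have deriv: "((\<lambda>y. u (k y)) has_derivative (\<lambda>h. G (x, 0) \<bullet> k' h)) (at s within S)"
      if "k s = (x, 0)" "(k has_derivative k') (at s within S)" "k ` S \<subseteq> upper_half"
      for k :: "'b::real_normed_vector \<Rightarrow> _" and k' s S
      using has_derivative_in_compose[OF that(2), of u "\<lambda>h. G (x, 0) \<bullet> h"]
        has_derivative_subset[OF GN(1) that(3)] that(1) by simp
    have "((\<lambda>y. u (y, 0)) has_derivative (\<lambda>h. G (x, 0) \<bullet> (h, 0))) (at x)"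
      by (rule deriv) (auto intro!: derivative_eq_intros)
    moreover have "((\<lambda>y. u (y, 0)) has_derivative (\<lambda>h. 0)) (at x)"
    proof -
      have "open {y. Rf < norm y}" by (intro open_Collect_less continuous_intros)
      then have "eventually (\<lambda>y. y \<in> {y. Rf < norm y}) (nhds x)"
        using x by (intro eventually_nhds_in_open) auto
      then have "eventually (\<lambda>y. 0 = u (y, 0)) (nhds x)"
        by eventually_elim (use assms(11) Rf in auto)
      then show ?thesis
        using has_derivative_transform_eventually[of "\<lambda>z. 0" "\<lambda>h. 0" x UNIV "\<lambda>y. u (y, 0)"]
        by (simp add: eventually_nhds_conv_at)
    qed
    ultimately have "(\<lambda>h. G (x, 0) \<bullet> (h, 0)) = (\<lambda>h. 0)" by (rule has_derivative_unique)
    then have space: "G (x, 0) \<bullet> (h, 0) = 0" for h by (rule fun_cong)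
    have "((\<lambda>t. u (x, t)) has_derivative (\<lambda>h. G (x, 0) \<bullet> (0, h))) (at 0 within {0..})"
      by (rule deriv) (auto intro!: derivative_eq_intros)
    then have "((\<lambda>t. u (x, t)) has_vector_derivative G (x, 0) \<bullet> (0, 1)) (at 0 within {0..})"
      by (simp add: has_vector_derivative_def inner_prod_def mult_ac)
    moreover have "((\<lambda>t. u (x, t)) has_vector_derivative g x) (at 0 within {0..})"
      using assms(12) by (simp add: has_real_derivative_iff_has_vector_derivative)
    moreover have "at (0::real) within {0..} \<noteq> bot"
    proof -
      have "{0..} - {0} = {0::real<..}" by auto
      then show ?thesis by (simp add: at_within_eq_bot_iff)
    qed
    ultimately have "G (x, 0) \<bullet> (0, 1) = g x"
      using vector_derivative_unique_within by blast
    then have "G (x, 0) \<bullet> (0, 1) = 0" using Rg x by simp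
    moreover have "G (x, 0) \<bullet> G (x, 0) = G (x, 0) \<bullet> (fst (G (x, 0)), 0) + snd (G (x, 0)) * (G (x, 0) \<bullet> (0, 1))"
      by (simp add: inner_prod_def)
    ultimately have "G (x, 0) \<bullet> G (x, 0) = 0" using space by simp
    then show ?thesis by simp
  qed
  interpret superlinear_wave u G N \<phi> A p "max Rf Rg"
    by unfold_locales (use GN assms Ap Rf Rg G0 in auto)
  obtain B where B: "\<And>x t. 0 < t \<Longrightarrow> \<bar>u (x, t)\<bar> \<le> B" using u_bounded by blast
  obtain C where C: "1 \<le> C" "\<And>s. \<bar>s\<bar> \<le> B \<Longrightarrow> \<phi> s \<le> C * \<bar>s\<bar>"
    using locally_linear_bound[OF assms(1-3)] by blast
  have pos: "u (x, t) = 0" if "0 < t" for x t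
    using u_eq_0[OF C(1) C(2)[OF B] that] .
  show ?thesis
  proof (intro allI impI)
    fix x and t :: real assume "0 \<le> t"
    \<comment> \<open>The equation is available for t > 0 only; the initial time follows by
      continuity.\<close>
    have "u (x, t) = 0" if "t \<in> closure {0<..}" for t
    proof (rule continuous_constant_on_closure[of "{0<..}" "\<lambda>t. u (x, t)"])
      show "continuous_on (closure {0<..}) (\<lambda>t. u (x, t))"
        by (rule continuous_on_compose2[OF u_cont]) (auto intro!: continuous_intros)
    qed (use pos that in auto)
    then show "u (x, t) = 0" using \<open>0 \<le> t\<close> by simp
  qed
qed

end
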